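(* Let $\psi$ be given either by Dieterich's law $\psi(\alpha,V)=\frac VL\alpha+e^{-\alpha}$ or by Ruina's law $\psi(\alpha,V)=\frac VL\left(\frac12\alpha^2+\log(V/L)\,\alpha\right)$. Then, for $n=1,\dots,N$ and any given velocity $\dot u\in H_0^{u_{n-1}}$, the spatial state problem $$\alpha_n\in L^2(\Gamma^F):\quad(\alpha_n,\beta-\alpha_n)_{L^2(\Gamma^F)}+\tau\Psi^{u_{n-1}}(\beta,\dot u)-\tau\Psi^{u_{n-1}}(\alpha_n,\dot u)\ \ge\ (\alpha_{n-1},\beta-\alpha_n)_{L^2(\Gamma^F)}\quad\forall\beta\in L^2(\Gamma^F)$$ has a unique solution $\alpha_n\in L^2(\Gamma^F)$.
   Context: **Geometry.** Let $d\in\{2,3\}$. The reference domain $\Omega\subset\mathbb{R}^d$ is decomposed into non-empty bounded Lipschitz domains $\Omega_1,\dots,\Omega_I$, $\overline\Omega=\bigcup_i\overline\Omega_i$, which do not penetrate each other and are layered: the only non-empty intersections of closures of different subdomains are the common interfaces $\Gamma^F_{i,i+1}=\overline\Omega_i\cap\overline\Omega_{i+1}$, $i=1,\dots,I-1$. Set $\Gamma^F_{0,1}=\Gamma^F_{I,I+1}=\emptyset$. Each boundary is disjointly decomposed as $\partial\Omega_i=\Gamma^D_i\cup\Gamma^N_i\cup(\Gamma^F_{i-1,i}\cup\Gamma^F_{i,i+1})$, and $\Gamma^D=\bigcup_i\Gamma^D_i$, $\Gamma^F=\bigcup_{i=1}^{I-1}\Gamma^F_{i,i+1}$. **Spaces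 and jumps.** $H=H^1(\Omega_1)^d\times\cdots\times H^1(\Omega_I)^d$ and $H_0=\{v\in H: v=0\text{ on }\Gamma^D\}$. For $v=(v_1,\dots,v_I)$ the bottom and top traces on $\Gamma^F$ are $v_B|_{\Gamma^F_{i,i+1}}=v_i|_{\Gamma^F_{i,i+1}}$ and $v_T|_{\Gamma^F_{i,i+1}}=v_{i+1}|_{\Gamma^F_{i,i+1}}$. For a deformation $u\in H_0$ put $\mathcal C^u=(\mathrm{Id}+u_B)(\Gamma^F)\cap(\mathrm{Id}+u_T)(\Gamma^F)$, $\Gamma^{F,u}_B=(\mathrm{Id}+u_B)^{-1}(\mathcal C^u)\subset\Gamma^F$, $\Gamma^{F,u}_T=(\mathrm{Id}+u_T)^{-1}(\mathcal C^u)\subset\Gamma^F$. The contact mapping is the bijection $\pi^u=(\mathrm{Id}+u_T)^{-1}\circ(\mathrm{Id}+u_B):\Gamma^{F,u}_B\to\Gamma^{F,u}_T$; the jump is $[v]^u=v_B-v_T\circ\pi^u$ on $\Gamma^{F,u}_B$; $n^u$ is the pullback to $\Gamma_B^{F,u}$ under $\mathrm{Id}+u_B$ of the unit normal field of $\mathcal C^u$ that is outward to the deformed bottom subdomains; and $H_0^u=\{v\in H_0:[v]^u\cdot n^u=0\text{ on }\Gamma_B^{F,u}\}$. **Standing assumption.** The given deformation $u_{n-1}$ of the preceding time step avoids self-penetration (each $\mathrm{Id}+u_{n-1,i}$ is injective, and deformed copies of different interfaces do not get into contact), and the contact mapping $\pi^{u_{n-1}}$ is sufficiently regular, so that $\pi^{u_{n-1}}$,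 $n^{u_{n-1}}$ and the closed subspace $H_0^{u_{n-1}}\subset H_0$ are well-defined and the jump $[\cdot]^{u_{n-1}}$ inherits the integrability of the traces $v_B,v_T$ of $H^1$-functions (i.e. $\pi^{u_{n-1}}$ and its inverse distort surface measure only by bounded factors). **State problem data.** $\tau>0$ is the time step size, $\alpha_{n-1}\in L^2(\Gamma^F)$ is the given state from the preceding time step, $L>0$ is a constant, and $V\ge0$, $\alpha\in\mathbb{R}$ in the formulas for $\psi$, with the convention $V\log(V/L)=0$ for $V=0$. The functional $\Psi^{u}(\cdot,\dot u):L^2(\Gamma^F)\to\mathbb{R}\cup\{+\infty\}$ is $$\Psi^u(\beta,\dot u)=\int_{\Gamma_B^{F,u}}\psi\big(\beta,|[\dot u]^u|\big)\,ds .$$ *)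

theory Defs
  imports "HOL-Analysis.Analysis"
begin

text \<open>The Hausdorff measure of dimension k, on its Caratheodory-measurable sets. It is normalised
  so that it is k-dimensional area on k-dimensional Lipschitz surfaces. The unbounded sets are
  excluded from the coverings because diameter is not meaningful for them.\<close>

definition hausdorff_content :: "nat \<Rightarrow> real \<Rightarrow> 'a::metric_space set \<Rightarrow> ennreal" where
  "hausdorff_content k \<delta> A =
     (INF C \<in> {C :: nat \<Rightarrow> 'a set. A \<subseteq> (\<Union>j. C j) \<and> (\<forall>j. bounded (C j) \<and> diameter (C j) \<le> \<delta>)}.
        \<Sum>j. if C j = {} then 0 else ennreal (unit_ball_vol (real k) * (diameter (C j) / 2) ^ k))"

definition hausdorff_outer :: "nat \<Rightarrow> 'a::metric_space set \<Rightarrow> ennreal" where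
  "hausdorff_outer k A = (SUP \<delta> \<in> {0<..}. hausdorff_content k \<delta> A)"

definition hausdorff_measure :: "nat \<Rightarrow> 'a::metric_space measure" where
  "hausdorff_measure k =
     measure_of UNIV (lambda_system UNIV (Pow UNIV) (hausdorff_outer k)) (hausdorff_outer k)"

definition surf :: "'a::euclidean_space measure" where
  "surf = hausdorff_measure (DIM('a) - 1)"

abbreviation surf_on :: "'a::euclidean_space set \<Rightarrow> 'a measure" where
  "surf_on A \<equiv> restrict_space surf A"

text \<open>Lebesgue and Sobolev functions are represented by everywhere defined functions; elements
  of the quotient spaces are equal if the representatives agree almost everywhere.\<close>

definition L2_space :: "'a measure \<Rightarrow> ('a \<Rightarrow> 'b::euclidean_space) set" where
  "L2_space M = {f \<in> borel_measurable M. integrable M (\<lambda>x. (norm (f x))\<^sup>2)}"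

definition L2_inner :: "'a measure \<Rightarrow> ('a \<Rightarrow> real) \<Rightarrow> ('a \<Rightarrow> real) \<Rightarrow> real" where
  "L2_inner M f g = (\<integral>x. f x * g x \<partial>M)"

definition L2_tendsto ::
    "'a measure \<Rightarrow> (nat \<Rightarrow> 'a \<Rightarrow> 'b::euclidean_space) \<Rightarrow> ('a \<Rightarrow> 'b) \<Rightarrow> bool" where
  "L2_tendsto M f g \<longleftrightarrow> (\<lambda>k. \<integral>\<^sup>+x. ennreal ((norm (f k x - g x))\<^sup>2) \<partial>M) \<longlonglongrightarrow> 0"

definition partial_deriv :: "'a::euclidean_space \<Rightarrow> ('a \<Rightarrow> real) \<Rightarrow> 'a \<Rightarrow> real" where
  "partial_deriv b f x = deriv (\<lambda>t. f (x + t *\<^sub>R b)) 0"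

definition grad :: "('a::euclidean_space \<Rightarrow> real) \<Rightarrow> 'a \<Rightarrow> 'a" where
  "grad f x = (\<Sum>b\<in>Basis. partial_deriv b f x *\<^sub>R b)"

primrec Ck :: "nat \<Rightarrow> ('a::euclidean_space \<Rightarrow> real) \<Rightarrow> bool" where
  "Ck 0 f \<longleftrightarrow> continuous_on UNIV f"
| "Ck (Suc k) f \<longleftrightarrow> continuous_on UNIV f \<and>
     (\<forall>b\<in>Basis. (\<forall>x. (\<lambda>t. f (x + t *\<^sub>R b)) differentiable (at 0)) \<and> Ck k (partial_deriv b f))"

definition smooth :: "('a::euclidean_space \<Rightarrow> real) \<Rightarrow> bool" where
  "smooth f \<longleftrightarrow> (\<forall>k. Ck k f)"

definition test_function :: "'a::euclidean_space set \<Rightarrow> ('a \<Rightarrow> real) \<Rightarrow> bool" where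
  "test_function D \<phi> \<longleftrightarrow>
     smooth \<phi> \<and> compact (closure {x. \<phi> x \<noteq> 0}) \<and> closure {x. \<phi> x \<noteq> 0} \<subseteq> D"

definition weak_gradient :: "'a::euclidean_space set \<Rightarrow> ('a \<Rightarrow> real) \<Rightarrow> ('a \<Rightarrow> 'a) \<Rightarrow> bool" where
  "weak_gradient D f G \<longleftrightarrow>
     (\<forall>\<phi> b. test_function D \<phi> \<longrightarrow> b \<in> Basis \<longrightarrow>
        (\<integral>x. f x * partial_deriv b \<phi> x \<partial>lebesgue_on D) = - (\<integral>x. (G x \<bullet> b) * \<phi> x \<partial>lebesgue_on D))"

definition H1_space :: "'a::euclidean_space set \<Rightarrow> ('a \<Rightarrow> real) set" where
  "H1_space D = {f \<in> L2_space (lebesgue_on D). \<exists>G \<in> L2_space (lebesgue_on D). weak_gradient D f G}"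

text \<open>The trace operator is the continuous extension to \<open>H\<^sup>1\<close> of the restriction to the boundary
  of functions that are smooth up to the boundary.\<close>

definition is_trace :: "'a::euclidean_space set \<Rightarrow> ('a \<Rightarrow> real) \<Rightarrow> ('a \<Rightarrow> real) \<Rightarrow> bool" where
  "is_trace D f g \<longleftrightarrow> g \<in> L2_space (surf_on (frontier D)) \<and>
     (\<exists>\<phi> G. (\<forall>k. smooth (\<phi> k)) \<and> G \<in> L2_space (lebesgue_on D) \<and> weak_gradient D f G \<and>
        L2_tendsto (lebesgue_on D) \<phi> f \<and>
        L2_tendsto (lebesgue_on D) (\<lambda>k. grad (\<phi> k)) G \<and>
        L2_tendsto (surf_on (frontier D)) \<phi> g)"

text \<open>The vector-valued space \<open>H\<^sup>1(D)\<^sup>d\<close> on a bounded Lipschitz domain. A representative is a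
  function on the closure of D whose values on the boundary represent its trace; every class has
  such a representative by the trace theorem. So boundary values can be taken pointwise.\<close>

definition H1_vec :: "'a::euclidean_space set \<Rightarrow> ('a \<Rightarrow> 'a) set" where
  "H1_vec D = {v. \<forall>b\<in>Basis. (\<lambda>x. v x \<bullet> b) \<in> H1_space D \<and>
                    is_trace D (\<lambda>x. v x \<bullet> b) (\<lambda>x. v x \<bullet> b)}"

text \<open>The integral with values in the extended reals. It is meaningful if the integral of the
  negative part is finite.\<close>

definition ext_integral :: "'a measure \<Rightarrow> ('a \<Rightarrow> real) \<Rightarrow> ereal" where
  "ext_integral M f =
     enn2ereal (\<integral>\<^sup>+x. ennreal (f x) \<partial>M) - enn2ereal (\<integral>\<^sup>+x. ennreal (- f x) \<partial>M)"

text \<open>Locally, in a cylinder with axis \<open>\<nu>\<close> around a boundary point, the domain is the region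
  strictly above the graph of a Lipschitz function \<open>\<gamma>\<close> on the hyperplane orthogonal to \<open>\<nu>\<close>.\<close>

definition lipschitz_domain :: "'a::euclidean_space set \<Rightarrow> bool" where
  "lipschitz_domain D \<longleftrightarrow> open D \<and> connected D \<and>
     (\<forall>p \<in> frontier D. \<exists>\<nu> \<gamma> C r h. norm \<nu> = 1 \<and> r > 0 \<and> h > 0 \<and>
        C-lipschitz_on {z. z \<bullet> \<nu> = 0} (\<gamma> :: 'a \<Rightarrow> real) \<and>
        (\<forall>z t. z \<bullet> \<nu> = 0 \<longrightarrow> norm z < r \<longrightarrow> \<bar>t\<bar> < h \<longrightarrow>
           (p + z + t *\<^sub>R \<nu> \<in> D \<longleftrightarrow> \<gamma> z < t)))"

definition iface :: "nat \<Rightarrow> (nat \<Rightarrow> 'a::euclidean_space set) \<Rightarrow> nat \<Rightarrow> 'a set" where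
  "iface I Om i =
     (if 1 \<le> i \<and> i < I then closure (Om i) \<inter> closure (Om (Suc i)) else {})"

definition fault :: "nat \<Rightarrow> (nat \<Rightarrow> 'a::euclidean_space set) \<Rightarrow> 'a set" where
  "fault I Om = (\<Union>i\<in>{1..<I}. iface I Om i)"

definition layered_decomposition ::
    "'a::euclidean_space set \<Rightarrow> nat \<Rightarrow> (nat \<Rightarrow> 'a set) \<Rightarrow> (nat \<Rightarrow> 'a set) \<Rightarrow> (nat \<Rightarrow> 'a set) \<Rightarrow> bool"
where
  "layered_decomposition \<Omega> I Om \<Gamma>D \<Gamma>N \<longleftrightarrow>
     open \<Omega> \<and> connected \<Omega> \<and> 1 \<le> I \<and>
     (\<forall>i\<in>{1..I}. Om i \<noteq> {} \<and> bounded (Om i) \<and> lipschitz_domain (Om i)) \<and>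
     closure \<Omega> = (\<Union>i\<in>{1..I}. closure (Om i)) \<and>
     (\<forall>i\<in>{1..I}. \<forall>j\<in>{1..I}. i \<noteq> j \<longrightarrow> Om i \<inter> Om j = {}) \<and>
     (\<forall>i\<in>{1..I}. \<forall>j\<in>{1..I}. i < j \<longrightarrow>
        (closure (Om i) \<inter> closure (Om j) \<noteq> {} \<longleftrightarrow> j = Suc i)) \<and>
     (\<forall>i\<in>{1..I}.
        frontier (Om i) = \<Gamma>D i \<union> \<Gamma>N i \<union> (iface I Om (i - 1) \<union> iface I Om i) \<and>
        \<Gamma>D i \<inter> \<Gamma>N i = {} \<and>
        (\<Gamma>D i \<union> \<Gamma>N i) \<inter> (iface I Om (i - 1) \<union> iface I Om i) = {})"

text \<open>A family \<open>(v\<^sub>1, \<dots>, v\<^sub>I)\<close> is a function on the indices; its values at other indices are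
  irrelevant.\<close>

definition H_space :: "nat \<Rightarrow> (nat \<Rightarrow> 'a::euclidean_space set) \<Rightarrow> (nat \<Rightarrow> 'a \<Rightarrow> 'a) set" where
  "H_space I Om = {v. \<forall>i\<in>{1..I}. v i \<in> H1_vec (Om i)}"

definition H0_space ::
    "nat \<Rightarrow> (nat \<Rightarrow> 'a::euclidean_space set) \<Rightarrow> (nat \<Rightarrow> 'a set) \<Rightarrow> (nat \<Rightarrow> 'a \<Rightarrow> 'a) set" where
  "H0_space I Om \<Gamma>D =
     {v \<in> H_space I Om. \<forall>i\<in>{1..I}. AE x in surf. x \<in> \<Gamma>D i \<longrightarrow> v i x = 0}"

definition iface_index :: "nat \<Rightarrow> (nat \<Rightarrow> 'a::euclidean_space set) \<Rightarrow> 'a \<Rightarrow> nat" where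
  "iface_index I Om x = (THE i. x \<in> iface I Om i)"

definition bottom_trace ::
    "nat \<Rightarrow> (nat \<Rightarrow> 'a::euclidean_space set) \<Rightarrow> (nat \<Rightarrow> 'a \<Rightarrow> 'a) \<Rightarrow> 'a \<Rightarrow> 'a" where
  "bottom_trace I Om v x = v (iface_index I Om x) x"

definition top_trace ::
    "nat \<Rightarrow> (nat \<Rightarrow> 'a::euclidean_space set) \<Rightarrow> (nat \<Rightarrow> 'a \<Rightarrow> 'a) \<Rightarrow> 'a \<Rightarrow> 'a" where
  "top_trace I Om v x = v (Suc (iface_index I Om x)) x"

definition bottom_map ::
    "nat \<Rightarrow> (nat \<Rightarrow> 'a::euclidean_space set) \<Rightarrow> (nat \<Rightarrow> 'a \<Rightarrow> 'a) \<Rightarrow> 'a \<Rightarrow> 'a" where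
  "bottom_map I Om u x = x + bottom_trace I Om u x"

definition top_map ::
    "nat \<Rightarrow> (nat \<Rightarrow> 'a::euclidean_space set) \<Rightarrow> (nat \<Rightarrow> 'a \<Rightarrow> 'a) \<Rightarrow> 'a \<Rightarrow> 'a" where
  "top_map I Om u x = x + top_trace I Om u x"

definition contact_set ::
    "nat \<Rightarrow> (nat \<Rightarrow> 'a::euclidean_space set) \<Rightarrow> (nat \<Rightarrow> 'a \<Rightarrow> 'a) \<Rightarrow> 'a set" where
  "contact_set I Om u = bottom_map I Om u ` fault I Om \<inter> top_map I Om u ` fault I Om"

definition contact_bottom ::
    "nat \<Rightarrow> (nat \<Rightarrow> 'a::euclidean_space set) \<Rightarrow> (nat \<Rightarrow> 'a \<Rightarrow> 'a) \<Rightarrow> 'a set" where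
  "contact_bottom I Om u = {x \<in> fault I Om. bottom_map I Om u x \<in> contact_set I Om u}"

definition contact_top ::
    "nat \<Rightarrow> (nat \<Rightarrow> 'a::euclidean_space set) \<Rightarrow> (nat \<Rightarrow> 'a \<Rightarrow> 'a) \<Rightarrow> 'a set" where
  "contact_top I Om u = {x \<in> fault I Om. top_map I Om u x \<in> contact_set I Om u}"

definition contact_map ::
    "nat \<Rightarrow> (nat \<Rightarrow> 'a::euclidean_space set) \<Rightarrow> (nat \<Rightarrow> 'a \<Rightarrow> 'a) \<Rightarrow> 'a \<Rightarrow> 'a" where
  "contact_map I Om u x = inv_into (fault I Om) (top_map I Om u) (bottom_map I Om u x)"

definition jump ::
    "nat \<Rightarrow> (nat \<Rightarrow> 'a::euclidean_space set) \<Rightarrow> (nat \<Rightarrow> 'a \<Rightarrow> 'a) \<Rightarrow> (nat \<Rightarrow> 'a \<Rightarrow> 'a) \<Rightarrow> 'a \<Rightarrow> 'a"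
where
  "jump I Om u v x = bottom_trace I Om v x - top_trace I Om v (contact_map I Om u x)"

text \<open>Outward unit normal of D at y: near y, the set D contains every open cone around the
  direction \<open>- \<nu>\<close>, and its complement every open cone around \<open>\<nu>\<close>, of aperture less than a half
  space. This determines \<open>\<nu>\<close>.\<close>

definition outward_unit_normal :: "'a::euclidean_space set \<Rightarrow> 'a \<Rightarrow> 'a \<Rightarrow> bool" where
  "outward_unit_normal D y \<nu> \<longleftrightarrow> norm \<nu> = 1 \<and>
     (\<forall>\<epsilon>>0. \<exists>r>0. \<forall>z\<in>ball y r.
        ((z - y) \<bullet> \<nu> < - \<epsilon> * norm (z - y) \<longrightarrow> z \<in> D) \<and>
        ((z - y) \<bullet> \<nu> > \<epsilon> * norm (z - y) \<longrightarrow> z \<notin> D))"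

text \<open>At \<open>x \<in> \<Gamma>\<^sup>F\<^bsub>i,i+1\<^esub>\<close> the deformed bottom subdomain is \<open>(Id + u\<^sub>i)(\<Omega>\<^sub>i)\<close>.\<close>

definition deformed_bottom ::
    "nat \<Rightarrow> (nat \<Rightarrow> 'a::euclidean_space set) \<Rightarrow> (nat \<Rightarrow> 'a \<Rightarrow> 'a) \<Rightarrow> 'a \<Rightarrow> 'a set" where
  "deformed_bottom I Om u x =
     (let i = iface_index I Om x in (\<lambda>z. z + u i z) ` Om i)"

definition contact_normal ::
    "nat \<Rightarrow> (nat \<Rightarrow> 'a::euclidean_space set) \<Rightarrow> (nat \<Rightarrow> 'a \<Rightarrow> 'a) \<Rightarrow> 'a \<Rightarrow> 'a" where
  "contact_normal I Om u x =
     (THE \<nu>. outward_unit_normal (deformed_bottom I Om u x) (bottom_map I Om u x) \<nu>)"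

definition H0_contact_space ::
    "nat \<Rightarrow> (nat \<Rightarrow> 'a::euclidean_space set) \<Rightarrow> (nat \<Rightarrow> 'a set) \<Rightarrow> (nat \<Rightarrow> 'a \<Rightarrow> 'a)
       \<Rightarrow> (nat \<Rightarrow> 'a \<Rightarrow> 'a) set" where
  "H0_contact_space I Om \<Gamma>D u =
     {v \<in> H0_space I Om \<Gamma>D.
        AE x in surf_on (contact_bottom I Om u). jump I Om u v x \<bullet> contact_normal I Om u x = 0}"

definition no_self_penetration ::
    "nat \<Rightarrow> (nat \<Rightarrow> 'a::euclidean_space set) \<Rightarrow> (nat \<Rightarrow> 'a \<Rightarrow> 'a) \<Rightarrow> bool" where
  "no_self_penetration I Om u \<longleftrightarrow>
     (\<forall>i\<in>{1..I}. inj_on (\<lambda>x. x + u i x) (closure (Om i))) \<and>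
     (\<forall>i\<in>{1..<I}. \<forall>j\<in>{1..<I}. i \<noteq> j \<longrightarrow>
        (bottom_map I Om u ` iface I Om i \<union> top_map I Om u ` iface I Om i) \<inter>
        (bottom_map I Om u ` iface I Om j \<union> top_map I Om u ` iface I Om j) = {})"

text \<open>The contact mapping and its inverse are measurable and distort surface measure by bounded
  factors only, and the normal field exists almost everywhere and is measurable. Then the jump
  maps \<open>H\<close> continuously into \<open>L\<^sup>2\<close>, so that \<open>H\<^sub>0\<^sup>u\<close> is a closed subspace of \<open>H\<^sub>0\<close>.\<close>

definition regular_contact ::
    "nat \<Rightarrow> (nat \<Rightarrow> 'a::euclidean_space set) \<Rightarrow> (nat \<Rightarrow> 'a \<Rightarrow> 'a) \<Rightarrow> bool" where
  "regular_contact I Om u \<longleftrightarrow>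
     (let B = contact_bottom I Om u; T = contact_top I Om u; \<pi> = contact_map I Om u in
        B \<in> sets surf \<and> T \<in> sets surf \<and>
        \<pi> \<in> measurable (surf_on B) (surf_on T) \<and>
        inv_into B \<pi> \<in> measurable (surf_on T) (surf_on B) \<and>
        (\<exists>K::real. \<forall>A\<in>sets surf. A \<subseteq> B \<longrightarrow>
           emeasure surf (\<pi> ` A) \<le> ennreal K * emeasure surf A \<and>
           emeasure surf A \<le> ennreal K * emeasure surf (\<pi> ` A)) \<and>
        (AE x in surf_on B.
           \<exists>\<nu>. outward_unit_normal (deformed_bottom I Om u x) (bottom_map I Om u x) \<nu>) \<and>
        contact_normal I Om u \<in> borel_measurable (surf_on B))"

text \<open>For \<open>V = 0\<close> the terms with \<open>ln\<close> vanish.\<close>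

definition dieterich_law :: "real \<Rightarrow> real \<Rightarrow> real \<Rightarrow> real" where
  "dieterich_law L \<alpha> V = V / L * \<alpha> + exp (- \<alpha>)"

definition ruina_law :: "real \<Rightarrow> real \<Rightarrow> real \<Rightarrow> real" where
  "ruina_law L \<alpha> V = V / L * (1 / 2 * \<alpha>\<^sup>2 + ln (V / L) * \<alpha>)"

definition state_functional ::
    "nat \<Rightarrow> (nat \<Rightarrow> 'a::euclidean_space set) \<Rightarrow> (real \<Rightarrow> real \<Rightarrow> real) \<Rightarrow> (nat \<Rightarrow> 'a \<Rightarrow> 'a)
       \<Rightarrow> ('a \<Rightarrow> real) \<Rightarrow> (nat \<Rightarrow> 'a \<Rightarrow> 'a) \<Rightarrow> ereal" where
  "state_functional I Om \<psi> u \<beta> v =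
     ext_integral (surf_on (contact_bottom I Om u)) (\<lambda>x. \<psi> (\<beta> x) (norm (jump I Om u v x)))"

text \<open>In the extended reals \<open>\<infinity> - \<infinity> = \<infinity>\<close>. This does not admit spurious solutions: if the functional
  is infinite at \<open>\<alpha>\<close>, then the inequality fails for each \<open>\<beta>\<close> at which it is finite, such as
  \<open>\<beta> = 0\<close>.\<close>

definition solves_state_problem ::
    "nat \<Rightarrow> (nat \<Rightarrow> 'a::euclidean_space set) \<Rightarrow> (real \<Rightarrow> real \<Rightarrow> real) \<Rightarrow> real \<Rightarrow> (nat \<Rightarrow> 'a \<Rightarrow> 'a)
       \<Rightarrow> (nat \<Rightarrow> 'a \<Rightarrow> 'a) \<Rightarrow> ('a \<Rightarrow> real) \<Rightarrow> ('a \<Rightarrow> real) \<Rightarrow> bool" where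
  "solves_state_problem I Om \<psi> \<tau> u v \<alpha>_prev \<alpha> \<longleftrightarrow>
     (let M = surf_on (fault I Om); \<Psi> = (\<lambda>\<beta>. state_functional I Om \<psi> u \<beta> v) in
        \<alpha> \<in> L2_space M \<and>
        (\<forall>\<beta>\<in>L2_space M.
           ereal (L2_inner M \<alpha> (\<lambda>x. \<beta> x - \<alpha> x)) + ereal \<tau> * \<Psi> \<beta> - ereal \<tau> * \<Psi> \<alpha>
             \<ge> ereal (L2_inner M \<alpha>_prev (\<lambda>x. \<beta> x - \<alpha> x))))"

end

theory Submission
  imports Defs
begin

text \<open>The state problem carries no spatial coupling: both the inner product of \<open>L\<^sup>2(\<Gamma>\<^sup>F)\<close> and the
  functional are integrals of pointwise expressions. So it is solved point by point. For fixed
  \<open>V = |[v]|\<close> at a point of the contact set, the minimiser of the strictly convex function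
  \<open>1/2 a\<^sup>2 - \<alpha>\<^bsub>n-1\<^esub> a + \<tau> \<psi>(a, V)\<close> is the solution of \<open>a - \<alpha>\<^bsub>n-1\<^esub> + \<tau> \<partial>\<psi>(a, V)/\<partial>a = 0\<close>, an explicit
  quotient for Ruina's law and the value of an increasing function of \<open>\<alpha>\<^bsub>n-1\<^esub> - \<tau> V / L\<close> for Dieterich's
  law. Off the contact set the state is unchanged. Convexity turns the pointwise equation into the
  pointwise inequality, which is then integrated (\<open>proximal_inequality_from_pointwise\<close>). Uniqueness
  comes from testing the inequalities of two solutions with each other, where the functional cancels
  and leaves \<open>- \<parallel>a - a'\<parallel>\<^sup>2 \<ge> 0\<close>.

  What needs proof is that the integrals make sense and that the pointwise solution is square
  integrable. Both rest on three facts. The fault is a measurable set of finite surface measure, since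
  closed sets are measurable for the Hausdorff measure by Caratheodory's criterion
  (\<open>closed_in_lambda_system_hausdorff\<close>) and bounded Lipschitz boundaries are covered by finitely many
  Lipschitz graphs (\<open>hausdorff_outer_frontier_Lipschitz_domain_finite\<close>). The slip rate \<open>V\<close> is square
  integrable, since the contact mapping distorts surface measure by a bounded factor
  (\<open>L2_space_jump\<close>). And the pointwise solutions as well as the negative parts of \<open>\<psi>\<close> grow at most
  linearly and quadratically, respectively, in the data. For Ruina's law the growth is that of
  \<open>s \<bar>ln s\<bar> / (1 + \<tau> s)\<close> and of \<open>s (ln s)\<^sup>2\<close> with \<open>s = V / L\<close>.\<close>

section \<open>Closed sets are Hausdorff measurable\<close>

definition hausdorff_weight :: "nat \<Rightarrow> 'a::metric_space set \<Rightarrow> ennreal" where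
  "hausdorff_weight k C =
     (if C = {} then 0 else ennreal (unit_ball_vol (real k) * (diameter C / 2) ^ k))"

definition fine_cover :: "real \<Rightarrow> 'a::metric_space set \<Rightarrow> (nat \<Rightarrow> 'a set) \<Rightarrow> bool" where
  "fine_cover \<delta> A C \<longleftrightarrow> A \<subseteq> (\<Union>j. C j) \<and> (\<forall>j. bounded (C j) \<and> diameter (C j) \<le> \<delta>)"

lemma hausdorff_content_alt:
  "hausdorff_content k \<delta> A = (INF C \<in> {C. fine_cover \<delta> A C}. \<Sum>j. hausdorff_weight k (C j))"
  unfolding hausdorff_content_def hausdorff_weight_def fine_cover_def by simp

lemma hausdorff_content_le:
  "fine_cover \<delta> A C \<Longrightarrow> hausdorff_content k \<delta> A \<le> (\<Sum>j. hausdorff_weight k (C j))"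
  unfolding hausdorff_content_alt by (rule INF_lower) simp

lemma hausdorff_weight_mono:
  assumes "C \<subseteq> D" "bounded D"
  shows "hausdorff_weight k C \<le> hausdorff_weight k D"
proof (cases "C = {}")
  case False
  then have "D \<noteq> {}" using assms by auto
  have "bounded C" using assms bounded_subset by blast
  then have "0 \<le> diameter C" "diameter C \<le> diameter D"
    using assms diameter_subset[OF assms] diameter_ge_0 by auto
  then have "unit_ball_vol (real k) * (diameter C / 2) ^ k \<le> unit_ball_vol (real k) * (diameter D / 2) ^ k"
    by (intro mult_left_mono power_mono) auto
  then show ?thesis
    using False \<open>D \<noteq> {}\<close> by (simp add: hausdorff_weight_def ennreal_leI)
qed (simp add: hausdorff_weight_def)

lemma hausdorff_content_empty: "0 \<le> \<delta> \<Longrightarrow> hausdorff_content k \<delta> {} = 0"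
  using hausdorff_content_le[of \<delta> "{}" "\<lambda>_. {}" k]
  by (simp add: fine_cover_def hausdorff_weight_def)

lemma hausdorff_outer_empty: "hausdorff_outer k {} = 0"
  unfolding hausdorff_outer_def by (simp add: hausdorff_content_empty)

lemma hausdorff_content_mono: "A \<subseteq> B \<Longrightarrow> hausdorff_content k \<delta> A \<le> hausdorff_content k \<delta> B"
  unfolding hausdorff_content_alt fine_cover_def by (rule INF_superset_mono) blast+

lemma hausdorff_outer_mono: "A \<subseteq> B \<Longrightarrow> hausdorff_outer k A \<le> hausdorff_outer k B"
  unfolding hausdorff_outer_def by (rule SUP_mono) (auto intro: hausdorff_content_mono)

lemma hausdorff_content_antimono:
  "\<delta> \<le> \<delta>' \<Longrightarrow> hausdorff_content k \<delta>' A \<le> hausdorff_content k \<delta> A"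
  unfolding hausdorff_content_alt fine_cover_def
  by (rule INF_superset_mono) (blast intro: order_trans, simp)

lemma hausdorff_content_le_outer: "0 < \<delta> \<Longrightarrow> hausdorff_content k \<delta> A \<le> hausdorff_outer k A"
  unfolding hausdorff_outer_def by (rule SUP_upper) simp

text \<open>Merge coverings of the sets \<open>A n\<close> that are optimal up to \<open>e / 2\<^bsup>n+1\<^esup>\<close>.\<close>

lemma hausdorff_content_countably_subadditive:
  fixes A :: "nat \<Rightarrow> 'a::metric_space set"
  shows "hausdorff_content k \<delta> (\<Union>n. A n) \<le> (\<Sum>n. hausdorff_content k \<delta> (A n))"
proof (rule ennreal_le_epsilon)
  fix e :: real
  assume fin: "(\<Sum>n. hausdorff_content k \<delta> (A n)) < top" and e: "0 < e"
  have "\<exists>C. fine_cover \<delta> (A n) C \<and>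
      (\<Sum>j. hausdorff_weight k (C j)) \<le> hausdorff_content k \<delta> (A n) + ennreal e * ennreal ((1/2) ^ Suc n)" for n
  proof -
    have "hausdorff_content k \<delta> (A n) < top"
      using fin by (rule ennreal_suminf_lessD)
    then have "hausdorff_content k \<delta> (A n) < hausdorff_content k \<delta> (A n) + ennreal e * ennreal ((1/2) ^ Suc n)"
      using e by (auto simp: ennreal_mult[symmetric] less_top_ennreal simp flip: ennreal_plus
          intro!: ennreal_lessI)
    then obtain C where "fine_cover \<delta> (A n) C"
      "(\<Sum>j. hausdorff_weight k (C j)) < hausdorff_content k \<delta> (A n) + ennreal e * ennreal ((1/2) ^ Suc n)"
      unfolding hausdorff_content_alt INF_less_iff by auto
    then show ?thesis by (auto intro: less_imp_le)
  qed
  then obtain C where C: "\<And>n. fine_cover \<delta> (A n) (C n)"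
    "\<And>n. (\<Sum>j. hausdorff_weight k (C n j)) \<le> hausdorff_content k \<delta> (A n) + ennreal e * ennreal ((1/2) ^ Suc n)"
    by metis
  define D where "D = case_prod C o prod_decode"
  have cover: "fine_cover \<delta> (\<Union>n. A n) D"
    unfolding fine_cover_def
  proof (intro conjI allI subsetI)
    fix x assume "x \<in> (\<Union>n. A n)"
    then obtain n j where "x \<in> C n j" using C(1) unfolding fine_cover_def by blast
    then have "x \<in> D (prod_encode (n, j))" by (simp add: D_def)
    then show "x \<in> (\<Union>j. D j)" by blast
  next
    fix j
    show "bounded (D j)" "diameter (D j) \<le> \<delta>"
      using C(1) by (auto simp: fine_cover_def D_def split: prod.splits)
  qed
  have "hausdorff_content k \<delta> (\<Union>n. A n) \<le> (\<Sum>j. hausdorff_weight k (D j))"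
    by (rule hausdorff_content_le[OF cover])
  also have "\<dots> = (\<Sum>j. (\<lambda>p. hausdorff_weight k (case_prod C p)) (prod_decode j))"
    by (simp add: D_def)
  also have "\<dots> = (\<Sum>n. \<Sum>j. hausdorff_weight k (C n j))"
    by (rule suminf_ennreal_2dimen) simp
  also have "\<dots> \<le> (\<Sum>n. hausdorff_content k \<delta> (A n) + ennreal e * ennreal ((1/2) ^ Suc n))"
    by (intro suminf_le C(2)) auto
  also have "\<dots> = (\<Sum>n. hausdorff_content k \<delta> (A n)) + (\<Sum>n. ennreal e * ennreal ((1/2) ^ Suc n))"
    by (rule suminf_add[symmetric]) auto
  also have "(\<Sum>n. ennreal e * ennreal ((1/2) ^ Suc n)) = ennreal e"
    unfolding ennreal_suminf_cmult
    by (subst suminf_ennreal_eq[OF zero_le_power power_half_series]) auto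
  finally show "hausdorff_content k \<delta> (\<Union>n. A n) \<le> (\<Sum>n. hausdorff_content k \<delta> (A n)) + ennreal e" .
qed

lemma hausdorff_outer_countably_subadditive:
  fixes A :: "nat \<Rightarrow> 'a::metric_space set"
  shows "hausdorff_outer k (\<Union>n. A n) \<le> (\<Sum>n. hausdorff_outer k (A n))"
  unfolding hausdorff_outer_def[of k "\<Union>n. A n"]
proof (rule SUP_least)
  fix \<delta> :: real assume "\<delta> \<in> {0<..}"
  then show "hausdorff_content k \<delta> (\<Union>n. A n) \<le> (\<Sum>n. hausdorff_outer k (A n))"
    by (intro order_trans[OF hausdorff_content_countably_subadditive] suminf_le
        hausdorff_content_le_outer) auto
qed

lemma binary_subadditive:
  fixes f :: "'a set \<Rightarrow> ennreal"
  assumes "f {} = 0" and sub: "\<And>A :: nat \<Rightarrow> 'a set. f (\<Union>n. A n) \<le> (\<Sum>n. f (A n))"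
  shows "f (X \<union> Y) \<le> f X + f Y"
proof -
  define A where "A n = (if n = 0 then X else if n = 1 then Y else {})" for n :: nat
  have "(\<Union>n. A n) = X \<union> Y"
    by (auto simp: A_def split: if_splits)
  moreover have "(\<Sum>n. f (A n)) = (\<Sum>n\<in>{0, 1}. f (A n))"
    by (rule suminf_finite) (auto simp: A_def assms(1))
  ultimately show ?thesis
    using sub[of A] by (simp add: A_def)
qed

lemma finite_subadditive:
  fixes f :: "'a set \<Rightarrow> ennreal"
  assumes "f {} = 0" and sub: "\<And>A :: nat \<Rightarrow> 'a set. f (\<Union>n. A n) \<le> (\<Sum>n. f (A n))"
    and "finite J"
  shows "f (\<Union>i\<in>J. C i) \<le> (\<Sum>i\<in>J. f (C i))"
  using \<open>finite J\<close>
proof (induction J)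
  case (insert i J)
  have "f (\<Union>i\<in>insert i J. C i) \<le> f (C i) + f (\<Union>i\<in>J. C i)"
    using binary_subadditive[OF assms(1) sub, of "C i" "\<Union>i\<in>J. C i"] by simp
  also have "\<dots> \<le> f (C i) + (\<Sum>i\<in>J. f (C i))"
    using insert.IH by (intro add_left_mono)
  finally show ?case using insert.hyps by simp
qed (simp add: assms(1))

lemmas hausdorff_outer_Un_le =
  binary_subadditive[OF hausdorff_outer_empty hausdorff_outer_countably_subadditive]

text \<open>In coverings by sets of diameter less than the distance of \<open>A\<close> and \<open>B\<close> each set serves only one of
  the two, so the covering splits. Coarser coverings do not matter because the content increases as
  the diameter bound decreases.\<close>

lemma hausdorff_outer_separated:
  fixes A B :: "'a::metric_space set"
  assumes r: "0 < r" "\<And>x y. x \<in> A \<Longrightarrow> y \<in> B \<Longrightarrow> r \<le> dist x y"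
  shows "hausdorff_outer k A + hausdorff_outer k B \<le> hausdorff_outer k (A \<union> B)"
proof -
  have small: "hausdorff_content k \<delta> A + hausdorff_content k \<delta> B \<le> hausdorff_content k \<delta> (A \<union> B)"
    if "\<delta> < r" for \<delta>
    unfolding hausdorff_content_alt[of k \<delta> "A \<union> B"]
  proof (rule INF_greatest)
    fix C assume "C \<in> {C. fine_cover \<delta> (A \<union> B) C}"
    then have C: "A \<union> B \<subseteq> (\<Union>j. C j)" "\<And>j. bounded (C j)" "\<And>j. diameter (C j) \<le> \<delta>"
      by (auto simp: fine_cover_def)
    have "fine_cover \<delta> A (\<lambda>j. C j \<inter> A)" "fine_cover \<delta> B (\<lambda>j. C j \<inter> B)"
      unfolding fine_cover_def using C
      by (auto intro: bounded_subset order_trans[OF diameter_subset])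
    then have "hausdorff_content k \<delta> A + hausdorff_content k \<delta> B
        \<le> (\<Sum>j. hausdorff_weight k (C j \<inter> A)) + (\<Sum>j. hausdorff_weight k (C j \<inter> B))"
      by (intro add_mono hausdorff_content_le)
    also have "\<dots> = (\<Sum>j. hausdorff_weight k (C j \<inter> A) + hausdorff_weight k (C j \<inter> B))"
      by (rule suminf_add) auto
    also have "\<dots> \<le> (\<Sum>j. hausdorff_weight k (C j))"
    proof (intro suminf_le)
      fix j
      (* A set of diameter below r cannot meet both A and B. *)
      have "C j \<inter> A = {} \<or> C j \<inter> B = {}"
      proof (rule ccontr)
        assume "\<not> (C j \<inter> A = {} \<or> C j \<inter> B = {})"
        then obtain x y where "x \<in> C j" "x \<in> A" "y \<in> C j" "y \<in> B" by auto
        then have "r \<le> dist x y" "dist x y \<le> diameter (C j)"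
          using r C(2) diameter_bounded_bound[of "C j" x y] by auto
        then show False using C(3)[of j] that by simp
      qed
      then show "hausdorff_weight k (C j \<inter> A) + hausdorff_weight k (C j \<inter> B) \<le> hausdorff_weight k (C j)"
        using hausdorff_weight_mono[of "C j \<inter> A" "C j" k] hausdorff_weight_mono[of "C j \<inter> B" "C j" k] C(2)
        by (auto simp: hausdorff_weight_def[of k "{}"])
    qed auto
    finally show "hausdorff_content k \<delta> A + hausdorff_content k \<delta> B \<le> (\<Sum>j. hausdorff_weight k (C j))" .
  qed
  have "hausdorff_outer k A + hausdorff_outer k B
      = (SUP \<delta>\<in>{0<..}. hausdorff_content k \<delta> A + hausdorff_content k \<delta> B)"
    unfolding hausdorff_outer_def
  proof (rule SUP_add_directed_ennreal[symmetric])
    fix i j :: real assume "i \<in> {0<..}" "j \<in> {0<..}"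
    then show "\<exists>m\<in>{0<..}. hausdorff_content k i A + hausdorff_content k j B
        \<le> hausdorff_content k m A + hausdorff_content k m B"
      by (intro bexI[of _ "min i j"] add_mono hausdorff_content_antimono) auto
  qed
  also have "\<dots> \<le> hausdorff_outer k (A \<union> B)"
  proof (rule SUP_least)
    fix \<delta> :: real assume "\<delta> \<in> {0<..}"
    then have pos: "0 < min \<delta> (r / 2)" using r by simp
    have "hausdorff_content k \<delta> A + hausdorff_content k \<delta> B
        \<le> hausdorff_content k (min \<delta> (r / 2)) A + hausdorff_content k (min \<delta> (r / 2)) B"
      by (intro add_mono hausdorff_content_antimono) auto
    also have "\<dots> \<le> hausdorff_content k (min \<delta> (r / 2)) (A \<union> B)"
      using r by (intro small) auto
    also have "\<dots> \<le> hausdorff_outer k (A \<union> B)"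
      using pos by (rule hausdorff_content_le_outer)
    finally show "hausdorff_content k \<delta> A + hausdorff_content k \<delta> B \<le> hausdorff_outer k (A \<union> B)" .
  qed
  finally show ?thesis .
qed

text \<open>Caratheodory's lemma on metric outer measures. The outer measure of the points of \<open>Y\<close> at distance at
  least \<open>1/(n+1)\<close> from \<open>F\<close> tends to that of \<open>Y\<close>: the rest of \<open>Y\<close> is a union of shells; the
  shells of even index are separated from each other, and so are those of odd index, so the outer
  measures of the shells have a finite sum, whose tails vanish. The additive constant \<open>c\<close> makes the lemma directly applicable to
  Caratheodory's measurability criterion.\<close>

lemma hausdorff_outer_le_of_exhaustion:
  fixes F Y :: "'a::metric_space set"
  assumes F: "closed F" "F \<noteq> {}" and Y: "Y \<inter> F = {}" and fin: "hausdorff_outer k Y < top"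
    and le: "\<And>n. c + hausdorff_outer k {x \<in> Y. 1 / (real n + 1) \<le> infdist x F} \<le> b"
  shows "c + hausdorff_outer k Y \<le> b"
proof -
  let ?H = "hausdorff_outer k"
  define d where "d x = infdist x F" for x
  define Z where "Z n = {x \<in> Y. 1 / (real n + 1) \<le> d x}" for n
  define R where "R n = {x \<in> Y. 1 / (real n + 2) \<le> d x \<and> d x < 1 / (real n + 1)}" for n
  have d_lip: "\<bar>d x - d y\<bar> \<le> dist x y" for x y
    unfolding d_def by (rule infdist_triangle_abs)
  have d_pos: "0 < d x" if "x \<in> Y" for x
    using that Y F infdist_pos_not_in_closed[of F x] unfolding d_def by auto
  have union: "Y \<subseteq> Z n \<union> (\<Union>m. R (m + n))" for n
  proof
    fix x assume x: "x \<in> Y"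
    show "x \<in> Z n \<union> (\<Union>m. R (m + n))"
    proof (cases "1 / (real n + 1) \<le> d x")
      case False
      obtain N where N: "1 / (real N + 1) < d x"
        using d_pos[OF x] by (metis nat_approx_posE of_nat_Suc add.commute)
      define m where "m = (LEAST m. 1 / (real m + 1) \<le> d x)"
      have m: "1 / (real m + 1) \<le> d x"
        unfolding m_def by (rule LeastI[of _ N]) (use N in simp)
      have "\<not> m \<le> n"
      proof
        assume "m \<le> n"
        then have "1 / (real n + 1) \<le> 1 / (real m + 1)" by (simp add: field_simps)
        then show False using m False by simp
      qed
      then obtain j where j: "m = Suc (j + n)" by (metis less_imp_Suc_add add.commute not_le)
      have "\<not> 1 / (real (j + n) + 1) \<le> d x"
        using not_less_Least[of "j + n" "\<lambda>m. 1 / (real m + 1) \<le> d x"] j unfolding m_def by simp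
      then have "x \<in> R (j + n)" using x m j by (simp add: R_def add.commute add.left_commute)
      then show ?thesis by blast
    qed (use x in \<open>simp add: Z_def\<close>)
  qed
  have every_other: "(\<Sum>j<N. ?H (R (2 * j + i))) \<le> ?H (\<Union>j<N. R (2 * j + i))" for N i
  proof (induction N)
    case (Suc N)
    have "(\<Sum>j<Suc N. ?H (R (2 * j + i))) \<le> ?H (\<Union>j<N. R (2 * j + i)) + ?H (R (2 * N + i))"
      using Suc by (simp add: add_right_mono)
    also have "\<dots> \<le> ?H ((\<Union>j<N. R (2 * j + i)) \<union> R (2 * N + i))"
    proof (cases "N = 0")
      case False
      let ?t = "real (2 * N + i)"
      show ?thesis
      proof (rule hausdorff_outer_separated)
        have "0 < ?t" using False by simp
        then show "0 < 1 / ?t - 1 / (?t + 1)" by (simp add: frac_less2)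
        fix x y assume "x \<in> (\<Union>j<N. R (2 * j + i))" and y: "y \<in> R (2 * N + i)"
        then obtain j where j: "j < N" "x \<in> R (2 * j + i)" by auto
        then have "1 / ?t \<le> 1 / (real (2 * j + i) + 2)"
          by (intro divide_left_mono) auto
        also have "\<dots> \<le> d x" using j by (simp add: R_def)
        finally have "1 / ?t \<le> d x" .
        moreover have "d y < 1 / (?t + 1)" using y by (simp add: R_def)
        ultimately show "1 / ?t - 1 / (?t + 1) \<le> dist x y" using d_lip[of x y] by linarith
      qed
    qed (simp add: hausdorff_outer_empty)
    also have "(\<Union>j<N. R (2 * j + i)) \<union> R (2 * N + i) = (\<Union>j<Suc N. R (2 * j + i))"
      by (auto simp: less_Suc_eq)
    finally show ?case .
  qed simp
  have "(\<Sum>m<n. ?H (R m)) \<le> ?H Y + ?H Y" for n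
  proof -
    have "(\<Sum>m<n. ?H (R m)) \<le> (\<Sum>m<2 * n. ?H (R m))"
      by (rule sum_mono2) auto
    also have "(\<Sum>m<2 * n. ?H (R m)) = (\<Sum>j<n. ?H (R (2 * j + 0))) + (\<Sum>j<n. ?H (R (2 * j + 1)))"
      by (induction n) (simp_all add: algebra_simps)
    also have "\<dots> \<le> ?H (\<Union>j<n. R (2 * j + 0)) + ?H (\<Union>j<n. R (2 * j + 1))"
      by (intro add_mono every_other)
    also have "\<dots> \<le> ?H Y + ?H Y"
      by (intro add_mono hausdorff_outer_mono) (auto simp: R_def)
    finally show ?thesis .
  qed
  then have "(\<Sum>m. ?H (R m)) \<le> ?H Y + ?H Y"
    by (intro suminf_le_const) auto
  then have sum_fin: "(\<Sum>m. ?H (R m)) < top"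
    using fin by (metis ennreal_add_less_top le_less_trans)
  define f where "f m = enn2real (?H (R m))" for m
  have H_f: "?H (R m) = ennreal (f m)" for m
    using ennreal_suminf_lessD[OF sum_fin, of m] by (simp add: f_def)
  have f_nonneg: "0 \<le> f m" for m by (simp add: f_def)
  have summable_f: "summable f"
    using f_nonneg sum_fin unfolding H_f by (intro summable_suminf_not_top) auto
  show ?thesis
  proof (rule ennreal_le_epsilon)
    fix e :: real assume "0 < e"
    then obtain n where n: "norm (\<Sum>m. f (m + n)) < e"
      using suminf_exist_split[OF _ summable_f] by blast
    have "?H Y \<le> ?H (Z n \<union> (\<Union>m. R (m + n)))"
      by (rule hausdorff_outer_mono[OF union])
    also have "\<dots> \<le> ?H (Z n) + (\<Sum>m. ?H (R (m + n)))"
      by (intro order_trans[OF hausdorff_outer_Un_le] add_left_mono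
          hausdorff_outer_countably_subadditive)
    also have "(\<Sum>m. ?H (R (m + n))) = ennreal (\<Sum>m. f (m + n))"
      unfolding H_f using f_nonneg summable_f
      by (intro suminf_ennreal2) (auto simp: summable_iff_shift)
    also have "\<dots> \<le> ennreal e"
      using n by (intro ennreal_leI) auto
    finally have "c + ?H Y \<le> c + (?H (Z n) + ennreal e)"
      by (simp add: add_left_mono)
    also have "\<dots> \<le> b + ennreal e"
      using le[of n] by (simp add: Z_def d_def add.assoc[symmetric] add_right_mono)
    finally show "c + ?H Y \<le> b + ennreal e" .
  qed
qed

lemma closed_in_lambda_system_hausdorff:
  fixes F :: "'a::metric_space set"
  assumes "closed F"
  shows "F \<in> lambda_system UNIV (Pow UNIV) (hausdorff_outer k)"
proof -
  let ?H = "hausdorff_outer k"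
  have "?H (F \<inter> X) + ?H ((UNIV - F) \<inter> X) = ?H X" for X
  proof (rule antisym)
    show "?H (F \<inter> X) + ?H ((UNIV - F) \<inter> X) \<le> ?H X"
    proof (cases "F = {} \<or> ?H X = top")
      case False
      show ?thesis
      proof (rule hausdorff_outer_le_of_exhaustion[OF assms])
        have "?H ((UNIV - F) \<inter> X) \<le> ?H X" by (rule hausdorff_outer_mono) auto
        then show "?H ((UNIV - F) \<inter> X) < top" using False by (simp add: less_top le_less_trans)
        fix n
        let ?Z = "{x \<in> (UNIV - F) \<inter> X. 1 / (real n + 1) \<le> infdist x F}"
        have "?H (F \<inter> X) + ?H ?Z \<le> ?H (F \<inter> X \<union> ?Z)"
        proof (rule hausdorff_outer_separated)
          fix x y assume "x \<in> F \<inter> X" "y \<in> ?Z"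
          then show "1 / (real n + 1) \<le> dist x y"
            using infdist_le[of x F y] by (simp add: dist_commute)
        qed simp
        also have "\<dots> \<le> ?H X" by (rule hausdorff_outer_mono) auto
        finally show "?H (F \<inter> X) + ?H ?Z \<le> ?H X" .
      qed (use False in auto)
    qed (auto simp: hausdorff_outer_empty)
    show "?H X \<le> ?H (F \<inter> X) + ?H ((UNIV - F) \<inter> X)"
      using hausdorff_outer_Un_le[of k "F \<inter> X" "(UNIV - F) \<inter> X"]
      by (simp add: Int_Un_distrib2[symmetric])
  qed
  then show ?thesis by (simp add: lambda_system_def)
qed

lemma space_surf [simp]: "space surf = UNIV"
  by (simp add: surf_def hausdorff_measure_def space_measure_of_conv)

lemma closed_sets_surf: "closed F \<Longrightarrow> F \<in> sets surf"
  using closed_in_lambda_system_hausdorff[of F]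
  by (simp add: surf_def hausdorff_measure_def sets_measure_of_conv)

text \<open>A generated measure agrees with the generating set function or is zero; the bound holds in both
  cases.\<close>

lemma emeasure_surf_le: "emeasure (surf :: 'a::euclidean_space measure) A \<le> hausdorff_outer (DIM('a) - 1) A"
  by (simp add: surf_def hausdorff_measure_def emeasure_measure_of_conv)

section \<open>Surface measure of Lipschitz boundaries and of the fault\<close>

lemma hausdorff_content_le_weight:
  fixes A :: "'a::metric_space set"
  assumes "bounded A" "diameter A \<le> \<delta>" "0 \<le> \<delta>"
  shows "hausdorff_content k \<delta> A \<le> hausdorff_weight k A"
proof -
  define C where "C n = (if n = 0 then A else {})" for n :: nat
  have "fine_cover \<delta> A C"
    using assms by (auto simp: fine_cover_def C_def split: if_splits)
  then have "hausdorff_content k \<delta> A \<le> (\<Sum>n. hausdorff_weight k (C n))"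
    by (rule hausdorff_content_le)
  also have "\<dots> = (\<Sum>n\<in>{0}. hausdorff_weight k (C n))"
    by (rule suminf_finite) (auto simp: C_def hausdorff_weight_def)
  finally show ?thesis by (simp add: C_def)
qed

text \<open>Only the \<open>d - 1\<close> coordinates other than \<open>b\<close> enter the Lipschitz bound, so of the order of
  \<open>m\<^bsup>d-1\<^esup>\<close> cells of side \<open>1/m\<close> suffice, and each contributes of the order of
  \<open>(1/m)\<^bsup>d-1\<^esup>\<close>. The product is bounded independently of \<open>m\<close>.\<close>

lemma hausdorff_outer_finite_of_codim1_parametrization:
  fixes g :: "'a::euclidean_space \<Rightarrow> 'a"
  assumes "bounded Z" and b: "b \<in> Basis" and "0 \<le> C"
    and lip: "\<And>z z'. z \<in> Z \<Longrightarrow> z' \<in> Z \<Longrightarrow>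
      dist (g z) (g z') \<le> C * (\<Sum>j\<in>Basis - {b}. \<bar>z \<bullet> j - z' \<bullet> j\<bar>)"
  shows "hausdorff_outer (DIM('a) - 1) (g ` Z) < top"
proof -
  let ?k = "DIM('a) - 1"
  define P where "P = (Basis - {b} :: 'a set)"
  have card_P: "card P = ?k" and fin_P: "finite P" using b by (simp_all add: P_def)
  obtain R0 where "\<And>z. z \<in> Z \<Longrightarrow> norm z \<le> R0"
    using \<open>bounded Z\<close> bounded_iff by blast
  moreover define R where "R = nat \<lceil>R0\<rceil>"
  ultimately have R: "\<And>z. z \<in> Z \<Longrightarrow> norm z \<le> real R" by (meson order_trans real_nat_ceiling_ge)
  define D where "D = C * real ?k"
  define K where "K = unit_ball_vol (real ?k) * (real (2 * R + 1) * (D / 2)) ^ ?k"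
  have "hausdorff_content ?k \<delta> (g ` Z) \<le> ennreal K" if "0 < \<delta>" for \<delta>
  proof -
    obtain m where m: "D / \<delta> < real m" "0 < m"
      by (metis reals_Archimedean2 gr0I max_less_iff_conj of_nat_0 less_irrefl)
    then have small: "D / real m \<le> \<delta>" using that by (simp add: field_simps)
    (* The cells of side 1/m partition Z, and the map distorts each to a set of diameter at most
       D/m. *)
    define q where "q z = (\<lambda>j\<in>P. \<lfloor>real m * (z \<bullet> j)\<rfloor>)" for z :: 'a
    define T where "T = PiE P (\<lambda>_. {- int (m * R)..int (m * R)})"
    have fin_T: "finite T" and card_T: "card T = (2 * (m * R) + 1) ^ ?k"
      using fin_P by (simp_all add: T_def finite_PiE card_PiE card_P nat_add_distrib nat_mult_distrib mult.commute)
    have q_T: "q z \<in> T" if "z \<in> Z" for z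
    proof -
      have "\<lfloor>real m * (z \<bullet> j)\<rfloor> \<in> {- int (m * R)..int (m * R)}" if "j \<in> P" for j
      proof -
        have "j \<in> Basis" using that by (simp add: P_def)
        then have "\<bar>z \<bullet> j\<bar> \<le> real R" using R[OF \<open>z \<in> Z\<close>] Basis_le_norm[of j z] by linarith
        then have "\<bar>real m * (z \<bullet> j)\<bar> \<le> real (m * R)"
          by (simp add: abs_mult mult_left_mono)
        then have "- real (m * R) \<le> real m * (z \<bullet> j)" "real m * (z \<bullet> j) \<le> real (m * R)"
          by linarith+
        then show ?thesis by (simp add: le_floor_iff floor_le_iff)
      qed
      then show ?thesis by (auto simp: q_def T_def)
    qed
    define S where "S t = g ` {z \<in> Z. q z = t}" for t
    have S_diam: "dist x y \<le> D / real m" if mem: "x \<in> S t" "y \<in> S t" for t x y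
    proof -
      obtain z z' where z: "x = g z" "y = g z'" "z \<in> Z" "z' \<in> Z" "q z = q z'"
        using mem by (auto simp: S_def)
      have "\<bar>z \<bullet> j - z' \<bullet> j\<bar> \<le> 1 / real m" if "j \<in> P" for j
      proof -
        have "\<lfloor>real m * (z \<bullet> j)\<rfloor> = \<lfloor>real m * (z' \<bullet> j)\<rfloor>"
          using fun_cong[OF z(5), of j] that by (simp add: q_def)
        then have "\<bar>real m * (z \<bullet> j) - real m * (z' \<bullet> j)\<bar> \<le> 1" by linarith
        then have "real m * \<bar>z \<bullet> j - z' \<bullet> j\<bar> \<le> 1"
          by (simp add: abs_mult right_diff_distrib[symmetric])
        then show ?thesis using \<open>0 < m\<close> by (simp add: field_simps)
      qed
      then have "(\<Sum>j\<in>P. \<bar>z \<bullet> j - z' \<bullet> j\<bar>) \<le> real ?k * (1 / real m)"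
        using sum_bounded_above[of P "\<lambda>j. \<bar>z \<bullet> j - z' \<bullet> j\<bar>" "1 / real m"] card_P by simp
      then have "C * (\<Sum>j\<in>P. \<bar>z \<bullet> j - z' \<bullet> j\<bar>) \<le> C * (real ?k * (1 / real m))"
        using \<open>0 \<le> C\<close> by (rule mult_left_mono)
      then show ?thesis using lip[OF z(3,4)] z by (simp add: P_def D_def)
    qed
    have D_nonneg: "0 \<le> D" using \<open>0 \<le> C\<close> by (simp add: D_def)
    have "hausdorff_content ?k \<delta> (S t) \<le> ennreal (unit_ball_vol (real ?k) * (D / real m / 2) ^ ?k)" for t
    proof (cases "S t = {}")
      case False
      have "bounded (S t)"
        using False S_diam[of _ t] unfolding bounded_def by blast
      have diam: "diameter (S t) \<le> D / real m"
        using S_diam D_nonneg by (intro diameter_le) (auto simp: dist_norm)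
      then have "hausdorff_content ?k \<delta> (S t) \<le> hausdorff_weight ?k (S t)"
        using small that by (intro hausdorff_content_le_weight \<open>bounded (S t)\<close>) auto
      also have "\<dots> \<le> ennreal (unit_ball_vol (real ?k) * (D / real m / 2) ^ ?k)"
        using False diam diameter_ge_0[OF \<open>bounded (S t)\<close>] unfolding hausdorff_weight_def
        by (auto intro!: ennreal_leI mult_left_mono power_mono divide_right_mono)
      finally show ?thesis .
    qed (use that in \<open>simp add: hausdorff_content_empty\<close>)
    then have "(\<Sum>t\<in>T. hausdorff_content ?k \<delta> (S t))
        \<le> of_nat (card T) * ennreal (unit_ball_vol (real ?k) * (D / real m / 2) ^ ?k)"
      by (intro sum_bounded_above)
    moreover have "hausdorff_content ?k \<delta> (\<Union>t\<in>T. S t) \<le> (\<Sum>t\<in>T. hausdorff_content ?k \<delta> (S t))"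
      using that fin_T
      by (intro finite_subadditive hausdorff_content_empty hausdorff_content_countably_subadditive) auto
    moreover have "(\<Union>t\<in>T. S t) = g ` Z" using q_T by (auto simp: S_def)
    ultimately have "hausdorff_content ?k \<delta> (g ` Z)
        \<le> of_nat (card T) * ennreal (unit_ball_vol (real ?k) * (D / real m / 2) ^ ?k)"
      by simp
    also have "\<dots> = ennreal (real (card T) * (unit_ball_vol (real ?k) * (D / real m / 2) ^ ?k))"
      using D_nonneg by (simp add: ennreal_mult ennreal_of_nat_eq_real_of_nat)
    also have "real (card T) * (unit_ball_vol (real ?k) * (D / real m / 2) ^ ?k)
        = unit_ball_vol (real ?k) * (real (2 * (m * R) + 1) * (D / real m / 2)) ^ ?k"
      unfolding card_T of_nat_power power_mult_distrib by (rule mult.left_commute)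
    also have "\<dots> \<le> K"
      unfolding K_def
    proof (intro mult_left_mono power_mono)
      have "real (2 * (m * R) + 1) \<le> real m * real (2 * R + 1)"
        using \<open>0 < m\<close> by (simp add: algebra_simps)
      then have "real (2 * (m * R) + 1) * (D / real m / 2) \<le> real m * real (2 * R + 1) * (D / real m / 2)"
        using D_nonneg by (intro mult_right_mono) auto
      also have "\<dots> = real (2 * R + 1) * (D / 2)" using \<open>0 < m\<close> by (simp add: field_simps)
      finally show "real (2 * (m * R) + 1) * (D / real m / 2) \<le> real (2 * R + 1) * (D / 2)" .
    qed (use D_nonneg in auto)
    finally show ?thesis by (simp add: ennreal_leI)
  qed
  then have "hausdorff_outer ?k (g ` Z) \<le> ennreal K"
    unfolding hausdorff_outer_def by (intro SUP_least) auto
  then show ?thesis by (simp add: le_less_trans)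
qed

lemma hausdorff_outer_Lipschitz_graph_finite:
  fixes p \<nu> :: "'a::euclidean_space" and \<gamma> :: "'a \<Rightarrow> real"
  assumes \<nu>: "norm \<nu> = 1" and lip: "C-lipschitz_on {z. z \<bullet> \<nu> = 0} \<gamma>"
  shows "hausdorff_outer (DIM('a) - 1) ((\<lambda>z. p + z + \<gamma> z *\<^sub>R \<nu>) ` {z. z \<bullet> \<nu> = 0 \<and> norm z < r}) < top"
proof -
  have "\<nu> \<noteq> 0" using \<nu> by auto
  then obtain b where b: "b \<in> Basis" "\<nu> \<bullet> b \<noteq> 0" by (metis euclidean_all_zero_iff)
  have C: "0 \<le> C" using lip by (rule lipschitz_on_nonneg)
  define s where "s w = (\<Sum>j\<in>Basis - {b}. \<bar>w \<bullet> j\<bar>)" for w :: 'a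
  (* On the hyperplane the coordinate b is determined by the others. *)
  have norm_le: "norm w \<le> (1 + 1 / \<bar>\<nu> \<bullet> b\<bar>) * s w" if "w \<bullet> \<nu> = 0" for w
  proof -
    have "(w \<bullet> b) * (\<nu> \<bullet> b) + (\<Sum>j\<in>Basis - {b}. (w \<bullet> j) * (\<nu> \<bullet> j)) = 0"
      using that b sum.remove[of Basis b "\<lambda>j. (w \<bullet> j) * (\<nu> \<bullet> j)"] euclidean_inner[of w \<nu>] by simp
    then have "\<bar>w \<bullet> b\<bar> * \<bar>\<nu> \<bullet> b\<bar> = \<bar>\<Sum>j\<in>Basis - {b}. (w \<bullet> j) * (\<nu> \<bullet> j)\<bar>"
      by (simp add: abs_mult[symmetric] add_eq_0_iff2)
    also have "\<dots> \<le> (\<Sum>j\<in>Basis - {b}. \<bar>(w \<bullet> j) * (\<nu> \<bullet> j)\<bar>)" by (rule sum_abs)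
    also have "\<dots> \<le> s w"
      unfolding s_def
    proof (rule sum_mono)
      fix j :: 'a assume "j \<in> Basis - {b}"
      then have "\<bar>\<nu> \<bullet> j\<bar> \<le> 1" using Basis_le_norm[of j \<nu>] \<nu> by simp
      then show "\<bar>(w \<bullet> j) * (\<nu> \<bullet> j)\<bar> \<le> \<bar>w \<bullet> j\<bar>"
        by (simp add: abs_mult mult_left_le)
    qed
    finally have "\<bar>w \<bullet> b\<bar> \<le> s w / \<bar>\<nu> \<bullet> b\<bar>" using b by (simp add: field_simps)
    moreover have "norm w \<le> \<bar>w \<bullet> b\<bar> + s w"
      using norm_le_l1[of w] b sum.remove[of Basis b "\<lambda>j. \<bar>w \<bullet> j\<bar>"] by (simp add: s_def)
    ultimately show ?thesis by (simp add: algebra_simps)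
  qed
  show ?thesis
  proof (rule hausdorff_outer_finite_of_codim1_parametrization[OF _ b(1)])
    show "bounded {z. z \<bullet> \<nu> = 0 \<and> norm z < r}"
      by (auto simp: bounded_iff intro: less_imp_le)
    show "0 \<le> (1 + C) * (1 + 1 / \<bar>\<nu> \<bullet> b\<bar>)" using C by simp
    fix z z' assume z: "z \<in> {z. z \<bullet> \<nu> = 0 \<and> norm z < r}" "z' \<in> {z. z \<bullet> \<nu> = 0 \<and> norm z < r}"
    have "dist (p + z + \<gamma> z *\<^sub>R \<nu>) (p + z' + \<gamma> z' *\<^sub>R \<nu>) = norm ((z - z') + (\<gamma> z - \<gamma> z') *\<^sub>R \<nu>)"
      by (simp add: dist_norm algebra_simps)
    also have "\<dots> \<le> norm (z - z') + \<bar>\<gamma> z - \<gamma> z'\<bar>"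
      using norm_triangle_ineq[of "z - z'" "(\<gamma> z - \<gamma> z') *\<^sub>R \<nu>"] \<nu> by simp
    also have "\<dots> \<le> (1 + C) * norm (z - z')"
      using lipschitz_onD[OF lip, of z z'] z by (simp add: dist_norm algebra_simps)
    also have "\<dots> \<le> (1 + C) * ((1 + 1 / \<bar>\<nu> \<bullet> b\<bar>) * s (z - z'))"
      using norm_le[of "z - z'"] z C by (intro mult_left_mono) (auto simp: inner_diff_left)
    finally show "dist (p + z + \<gamma> z *\<^sub>R \<nu>) (p + z' + \<gamma> z' *\<^sub>R \<nu>)
        \<le> (1 + C) * (1 + 1 / \<bar>\<nu> \<bullet> b\<bar>) * (\<Sum>j\<in>Basis - {b}. \<bar>z \<bullet> j - z' \<bullet> j\<bar>)"
      by (simp add: s_def inner_diff_left mult.assoc)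
  qed
qed

text \<open>Near a boundary point the boundary is contained in the graph of the Lipschitz function of the chart:
  a boundary point is not in the open set \<open>D\<close>, hence not above the graph, and a point strictly below
  it has a neighbourhood that misses \<open>D\<close>. Compactness reduces to finitely many charts.\<close>

lemma hausdorff_outer_frontier_Lipschitz_domain_finite:
  fixes D :: "'a::euclidean_space set"
  assumes "lipschitz_domain D" "bounded D"
  shows "hausdorff_outer (DIM('a) - 1) (frontier D) < top"
proof -
  let ?H = "hausdorff_outer (DIM('a) - 1) :: 'a set \<Rightarrow> _"
  have "open D" using assms by (simp add: lipschitz_domain_def)
  have "\<exists>e>0. ?H (frontier D \<inter> ball p e) < top" if "p \<in> frontier D" for p
  proof -
    have "\<exists>\<nu> (\<gamma> :: 'a \<Rightarrow> real) C r h. norm \<nu> = 1 \<and> r > 0 \<and> h > 0 \<and> C-lipschitz_on {z. z \<bullet> \<nu> = 0} \<gamma> \<and>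
        (\<forall>z t. z \<bullet> \<nu> = 0 \<longrightarrow> norm z < r \<longrightarrow> \<bar>t\<bar> < h \<longrightarrow> (p + z + t *\<^sub>R \<nu> \<in> D \<longleftrightarrow> \<gamma> z < t))"
      using assms(1) that unfolding lipschitz_domain_def by (elim conjE) (drule (1) bspec)
    then obtain \<nu> r h C and \<gamma> :: "'a \<Rightarrow> real" where chart: "norm \<nu> = 1 \<and> r > 0 \<and> h > 0 \<and>
        C-lipschitz_on {z. z \<bullet> \<nu> = 0} \<gamma> \<and>
        (\<forall>z t. z \<bullet> \<nu> = 0 \<longrightarrow> norm z < r \<longrightarrow> \<bar>t\<bar> < h \<longrightarrow> (p + z + t *\<^sub>R \<nu> \<in> D \<longleftrightarrow> \<gamma> z < t))"
      by (elim exE)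
    then have *: "norm \<nu> = 1" "r > 0" "h > 0" "C-lipschitz_on {z. z \<bullet> \<nu> = 0} \<gamma>" by blast+
    have above: "p + z + t *\<^sub>R \<nu> \<in> D \<longleftrightarrow> \<gamma> z < t" if "z \<bullet> \<nu> = 0" "norm z < r" "\<bar>t\<bar> < h" for z t
      using chart that by blast
    have \<nu>\<nu>: "\<nu> \<bullet> \<nu> = 1" using *(1) by (simp add: dot_square_norm)
    define t where "t x = (x - p) \<bullet> \<nu>" for x
    define z where "z x = x - p - t x *\<^sub>R \<nu>" for x
    have z_orth: "z x \<bullet> \<nu> = 0" for x by (simp add: z_def t_def inner_diff_left \<nu>\<nu>)
    have x_eq: "x = p + z x + t x *\<^sub>R \<nu>" for x by (simp add: z_def)
    define e where "e = min r h"
    have t_small: "\<bar>t x\<bar> < h" and z_small: "norm (z x) < r" if "x \<in> ball p e" for x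
    proof -
      have x: "norm (x - p) < e" using that by (simp add: dist_norm norm_minus_commute)
      have "\<bar>t x\<bar> \<le> norm (x - p)"
        using Cauchy_Schwarz_ineq2[of "x - p" \<nu>] *(1) by (simp add: t_def)
      then show "\<bar>t x\<bar> < h" using x by (simp add: e_def)
      have "(norm (w - (w \<bullet> \<nu>) *\<^sub>R \<nu>))\<^sup>2 = (norm w)\<^sup>2 - (w \<bullet> \<nu>)\<^sup>2" for w
        unfolding power2_norm_eq_inner
        by (simp add: inner_diff_left inner_diff_right inner_commute \<nu>\<nu> power2_eq_square)
      from this[of "x - p"] have "(norm (z x))\<^sup>2 \<le> (norm (x - p))\<^sup>2"
        by (simp add: z_def t_def)
      then have "norm (z x) \<le> norm (x - p)" by (rule power2_le_imp_le) simp
      then show "norm (z x) < r" using x by (simp add: e_def)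
    qed
    have D_iff: "x \<in> D \<longleftrightarrow> \<gamma> (z x) < t x" if "x \<in> ball p e" for x
      using above[OF z_orth z_small[OF that] t_small[OF that]] x_eq[of x] by simp
    have cont: "continuous_on UNIV (\<lambda>x. \<gamma> (z x) - t x)"
    proof (intro continuous_intros continuous_on_compose2[OF lipschitz_on_continuous_on[OF *(4)]])
      show "continuous_on UNIV z" "continuous_on UNIV t"
        unfolding z_def t_def by (intro continuous_intros)+
    qed (use z_orth in auto)
    have "frontier D \<inter> ball p e
        \<subseteq> (\<lambda>z. p + z + \<gamma> z *\<^sub>R \<nu>) ` {z. z \<bullet> \<nu> = 0 \<and> norm z < r}"
    proof
      fix x assume x: "x \<in> frontier D \<inter> ball p e"
      then have "x \<notin> D" "x \<in> closure D"
        using \<open>open D\<close> by (auto simp: frontier_def interior_open)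
      then have "t x \<le> \<gamma> (z x)" using D_iff x by force
      moreover have "\<not> t x < \<gamma> (z x)"
      proof
        assume "t x < \<gamma> (z x)"
        define U where "U = ball p e \<inter> {y. 0 < \<gamma> (z y) - t y}"
        have "open U"
          unfolding U_def using cont by (intro open_Int open_ball open_Collect_less) auto
        moreover have "x \<in> U" using x \<open>t x < \<gamma> (z x)\<close> by (simp add: U_def)
        moreover have "U \<inter> D = {}" using D_iff by (fastforce simp: U_def)
        ultimately show False
          using \<open>x \<in> closure D\<close> by (metis open_Int_closure_eq_empty disjoint_iff)
      qed
      ultimately have "x = p + z x + \<gamma> (z x) *\<^sub>R \<nu>" using x_eq[of x] by simp
      then show "x \<in> (\<lambda>z. p + z + \<gamma> z *\<^sub>R \<nu>) ` {z. z \<bullet> \<nu> = 0 \<and> norm z < r}"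
        using z_orth z_small x by blast
    qed
    then have "?H (frontier D \<inter> ball p e) < top"
      using hausdorff_outer_Lipschitz_graph_finite[OF *(1,4), of p r] hausdorff_outer_mono
      by (meson le_less_trans)
    moreover have "e > 0" using * by (simp add: e_def)
    ultimately show ?thesis by blast
  qed
  then obtain e where e: "\<And>p. p \<in> frontier D \<Longrightarrow> 0 < e p \<and> ?H (frontier D \<inter> ball p (e p)) < top"
    by metis
  have "compact (frontier D)" using assms by (simp add: compact_frontier_bounded)
  then obtain J where J: "J \<subseteq> frontier D" "finite J" "frontier D \<subseteq> (\<Union>p\<in>J. ball p (e p))"
    using e by (elim compactE_image[where C="frontier D" and f="\<lambda>p. ball p (e p)"]) auto
  have "?H (frontier D) \<le> ?H (\<Union>p\<in>J. frontier D \<inter> ball p (e p))"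
    using J by (intro hausdorff_outer_mono) auto
  also have "\<dots> \<le> (\<Sum>p\<in>J. ?H (frontier D \<inter> ball p (e p)))"
    using J hausdorff_outer_empty hausdorff_outer_countably_subadditive
    by (intro finite_subadditive) auto
  also have "\<dots> < top"
    using J e by (subst ennreal_sum_less_top) auto
  finally show ?thesis .
qed

lemma closed_iface: "closed (iface I Om i)"
  by (auto simp: iface_def)

lemma closed_fault: "closed (fault I Om)"
  unfolding fault_def by (intro closed_UN ballI closed_iface) auto

lemma iface_subset_frontier:
  assumes "layered_decomposition \<Omega> I Om \<Gamma>D \<Gamma>N" "i \<in> {1..<I}"
  shows "iface I Om i \<subseteq> frontier (Om i)" "iface I Om i \<subseteq> frontier (Om (Suc i))"
proof -
  have "\<forall>j\<in>{1..I}. frontier (Om j) = \<Gamma>D j \<union> \<Gamma>N j \<union> (iface I Om (j - 1) \<union> iface I Om j) \<and>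
      \<Gamma>D j \<inter> \<Gamma>N j = {} \<and>
      (\<Gamma>D j \<union> \<Gamma>N j) \<inter> (iface I Om (j - 1) \<union> iface I Om j) = {}"
    using assms(1) unfolding layered_decomposition_def by (elim conjE)
  then have *: "frontier (Om j) = \<Gamma>D j \<union> \<Gamma>N j \<union> (iface I Om (j - 1) \<union> iface I Om j)"
    if "j \<in> {1..I}" for j
    using that by simp
  show "iface I Om i \<subseteq> frontier (Om i)" using *[of i] assms(2) by auto
  show "iface I Om i \<subseteq> frontier (Om (Suc i))" using *[of "Suc i"] assms(2) by auto
qed

lemma emeasure_surf_fault_finite:
  fixes Om :: "nat \<Rightarrow> 'a::euclidean_space set"
  assumes "layered_decomposition \<Omega> I Om \<Gamma>D \<Gamma>N"
  shows "emeasure surf (fault I Om) < top"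
proof -
  let ?H = "hausdorff_outer (DIM('a) - 1) :: 'a set \<Rightarrow> _"
  have "emeasure surf (fault I Om) \<le> ?H (fault I Om)" by (rule emeasure_surf_le)
  also have "\<dots> \<le> (\<Sum>i\<in>{1..<I}. ?H (iface I Om i))"
    unfolding fault_def using hausdorff_outer_empty hausdorff_outer_countably_subadditive
    by (intro finite_subadditive) auto
  also have "\<dots> < top"
  proof (subst ennreal_sum_less_top, simp, intro ballI)
    fix i assume i: "i \<in> {1..<I}"
    then have "lipschitz_domain (Om i)" "bounded (Om i)"
      using assms by (auto simp: layered_decomposition_def)
    then have "?H (frontier (Om i)) < top"
      by (rule hausdorff_outer_frontier_Lipschitz_domain_finite)
    then show "?H (iface I Om i) < top"
      using hausdorff_outer_mono[OF iface_subset_frontier(1)[OF assms i]] by (meson le_less_trans)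
  qed
  finally show ?thesis .
qed

section \<open>Square integrable functions\<close>

lemma L2_space_iff:
  fixes f :: "'a \<Rightarrow> 'b::euclidean_space"
  shows "f \<in> L2_space M \<longleftrightarrow> f \<in> borel_measurable M \<and> (\<integral>\<^sup>+x. ennreal ((norm (f x))\<^sup>2) \<partial>M) < top"
proof -
  have "integrable M (\<lambda>x. (norm (f x))\<^sup>2) \<longleftrightarrow> (\<integral>\<^sup>+x. ennreal ((norm (f x))\<^sup>2) \<partial>M) < top"
    if "f \<in> borel_measurable M"
    using that by (simp add: integrable_iff_bounded)
  then show ?thesis by (auto simp: L2_space_def)
qed

lemma L2_spaceD: "f \<in> L2_space M \<Longrightarrow> f \<in> borel_measurable M"
  by (simp add: L2_space_def)

lemma L2_space_dominated:
  fixes f :: "'a \<Rightarrow> 'b::euclidean_space" and g :: "'a \<Rightarrow> 'c::euclidean_space"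
  assumes g: "g \<in> L2_space M" and f: "f \<in> borel_measurable M"
    and le: "\<And>x. x \<in> space M \<Longrightarrow> norm (f x) \<le> norm (g x)"
  shows "f \<in> L2_space M"
proof -
  have "(\<integral>\<^sup>+x. ennreal ((norm (f x))\<^sup>2) \<partial>M) \<le> (\<integral>\<^sup>+x. ennreal ((norm (g x))\<^sup>2) \<partial>M)"
    using le by (intro nn_integral_mono ennreal_leI power_mono) auto
  then show ?thesis using f g by (auto simp: L2_space_iff le_less_trans)
qed

lemma L2_space_add:
  fixes f g :: "'a \<Rightarrow> 'b::euclidean_space"
  assumes "f \<in> L2_space M" "g \<in> L2_space M"
  shows "(\<lambda>x. f x + g x) \<in> L2_space M"
proof -
  have [measurable]: "f \<in> borel_measurable M" "g \<in> borel_measurable M"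
    using assms by (auto simp: L2_space_def)
  have "integrable M (\<lambda>x. (norm (f x + g x))\<^sup>2)"
  proof (rule Bochner_Integration.integrable_bound)
    show "integrable M (\<lambda>x. 2 * (norm (f x))\<^sup>2 + 2 * (norm (g x))\<^sup>2)"
      using assms by (auto simp: L2_space_def)
    have "(norm (f x + g x))\<^sup>2 \<le> 2 * (norm (f x))\<^sup>2 + 2 * (norm (g x))\<^sup>2" for x
    proof -
      have "(norm (f x + g x))\<^sup>2 \<le> (norm (f x) + norm (g x))\<^sup>2"
        by (intro power_mono norm_triangle_ineq) auto
      also have "\<dots> \<le> 2 * (norm (f x))\<^sup>2 + 2 * (norm (g x))\<^sup>2"
        using zero_le_power2[of "norm (f x) - norm (g x)"]
        by (simp add: power2_eq_square algebra_simps)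
      finally show ?thesis .
    qed
    then show "AE x in M. norm ((norm (f x + g x))\<^sup>2) \<le> norm (2 * (norm (f x))\<^sup>2 + 2 * (norm (g x))\<^sup>2)"
      by simp
  qed simp
  then show ?thesis by (simp add: L2_space_def)
qed

lemma L2_space_zero: "(\<lambda>x. 0) \<in> L2_space M"
  by (simp add: L2_space_def)

lemma L2_space_scaleR:
  fixes c :: "'b::euclidean_space" and f :: "'a \<Rightarrow> real"
  assumes "f \<in> L2_space M"
  shows "(\<lambda>x. f x *\<^sub>R c) \<in> L2_space M"
  using assms by (auto simp: L2_space_def power_mult_distrib)

lemma L2_space_cmult:
  fixes c :: real and f :: "'a \<Rightarrow> real"
  assumes "f \<in> L2_space M"
  shows "(\<lambda>x. c * f x) \<in> L2_space M"
  using L2_space_scaleR[OF assms, of c] by (simp add: mult.commute)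

lemma L2_space_minus:
  fixes f :: "'a \<Rightarrow> 'b::euclidean_space"
  assumes "f \<in> L2_space M"
  shows "(\<lambda>x. - f x) \<in> L2_space M"
  using assms by (auto simp: L2_space_def)

lemma L2_space_diff:
  fixes f g :: "'a \<Rightarrow> 'b::euclidean_space"
  assumes "f \<in> L2_space M" "g \<in> L2_space M"
  shows "(\<lambda>x. f x - g x) \<in> L2_space M"
  using L2_space_add[OF assms(1) L2_space_minus[OF assms(2)]] by simp

lemma L2_space_norm:
  fixes f :: "'a \<Rightarrow> 'b::euclidean_space"
  assumes "f \<in> L2_space M"
  shows "(\<lambda>x. norm (f x)) \<in> L2_space M"
  using assms by (auto simp: L2_space_def)

lemma L2_space_sum:
  fixes f :: "'i \<Rightarrow> 'a \<Rightarrow> 'b::euclidean_space"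
  assumes "\<And>i. i \<in> J \<Longrightarrow> f i \<in> L2_space M"
  shows "(\<lambda>x. \<Sum>i\<in>J. f i x) \<in> L2_space M"
  using assms by (induction J rule: infinite_finite_induct) (auto intro: L2_space_add L2_space_zero)

lemma L2_space_const:
  fixes c :: "'b::euclidean_space"
  assumes "finite_measure M"
  shows "(\<lambda>x. c) \<in> L2_space M"
  using assms by (simp add: L2_space_def finite_measure.integrable_const)

lemma L2_space_integrable_mult:
  fixes f g :: "'a \<Rightarrow> real"
  assumes "f \<in> L2_space M" "g \<in> L2_space M"
  shows "integrable M (\<lambda>x. f x * g x)"
proof (rule Bochner_Integration.integrable_bound)
  show "integrable M (\<lambda>x. (norm (f x))\<^sup>2 + (norm (g x))\<^sup>2)"
    using assms by (auto simp: L2_space_def)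
  show "(\<lambda>x. f x * g x) \<in> borel_measurable M"
    using assms by (auto simp: L2_space_def)
  have "\<bar>f x * g x\<bar> \<le> (f x)\<^sup>2 + (g x)\<^sup>2" for x
    using sum_squares_bound[of "\<bar>f x\<bar>" "\<bar>g x\<bar>"] mult_nonneg_nonneg[of "\<bar>f x\<bar>" "\<bar>g x\<bar>"]
    by (simp add: abs_mult del: mult_nonneg_nonneg)
  then show "AE x in M. norm (f x * g x) \<le> norm ((norm (f x))\<^sup>2 + (norm (g x))\<^sup>2)"
    by simp
qed

lemma L2_space_cong:
  assumes "\<And>x. x \<in> space M \<Longrightarrow> f x = g x"
  shows "f \<in> L2_space M \<longleftrightarrow> g \<in> L2_space M"
proof -
  have "f \<in> borel_measurable M \<longleftrightarrow> g \<in> borel_measurable M"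
    using assms by (rule measurable_cong)
  moreover have "integrable M (\<lambda>x. (norm (f x))\<^sup>2) \<longleftrightarrow> integrable M (\<lambda>x. (norm (g x))\<^sup>2)"
    using assms by (intro Bochner_Integration.integrable_cong) auto
  ultimately show ?thesis by (simp add: L2_space_def)
qed

lemma L2_space_restrict_space_iff:
  fixes f :: "'a \<Rightarrow> 'b::euclidean_space"
  assumes "A \<inter> space M \<in> sets M"
  shows "f \<in> L2_space (restrict_space M A) \<longleftrightarrow> (\<lambda>x. indicator A x *\<^sub>R f x) \<in> L2_space M"
proof -
  have "(\<lambda>x. ennreal ((norm (f x))\<^sup>2) * indicator A x)
      = (\<lambda>x. ennreal ((norm (indicator A x *\<^sub>R f x))\<^sup>2))"
    by (auto simp: indicator_def)
  then show ?thesis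
    by (simp add: L2_space_iff borel_measurable_restrict_space_iff[OF assms]
        nn_integral_restrict_space[OF assms])
qed

lemma L2_space_restrict_space_subset:
  fixes f :: "'a \<Rightarrow> 'b::euclidean_space"
  assumes f: "f \<in> L2_space (restrict_space M A)" and A: "A \<in> sets M" and B: "B \<in> sets M" "B \<subseteq> A"
  shows "f \<in> L2_space (restrict_space M B)"
proof -
  have [simp]: "A \<inter> space M \<in> sets M" "B \<inter> space M \<in> sets M" using A B by auto
  have fA: "(\<lambda>x. indicator A x *\<^sub>R f x) \<in> L2_space M"
    using f by (simp add: L2_space_restrict_space_iff)
  have "(\<lambda>x. indicator B x *\<^sub>R (indicator A x *\<^sub>R f x)) \<in> L2_space M"
  proof (rule L2_space_dominated[OF fA])
    show "(\<lambda>x. indicator B x *\<^sub>R (indicator A x *\<^sub>R f x)) \<in> borel_measurable M"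
      using B L2_spaceD[OF fA] by measurable
  qed (simp add: indicator_def)
  also have "(\<lambda>x. indicator B x *\<^sub>R (indicator A x *\<^sub>R f x)) = (\<lambda>x. indicator B x *\<^sub>R f x)"
    using B by (intro ext) (auto split: split_indicator)
  finally show ?thesis by (simp add: L2_space_restrict_space_iff)
qed

lemma L2_space_restrict_space_UN:
  fixes f :: "'a \<Rightarrow> 'b::euclidean_space"
  assumes J: "finite J" "disjoint_family_on A J" and A: "\<And>i. i \<in> J \<Longrightarrow> A i \<in> sets M"
    and f: "\<And>i. i \<in> J \<Longrightarrow> f \<in> L2_space (restrict_space M (A i))"
  shows "f \<in> L2_space (restrict_space M (\<Union>i\<in>J. A i))"
proof -
  have "(\<lambda>x. \<Sum>i\<in>J. indicator (A i) x *\<^sub>R f x) \<in> L2_space M"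
    using A f by (intro L2_space_sum) (simp add: L2_space_restrict_space_iff)
  also have "(\<lambda>x. \<Sum>i\<in>J. indicator (A i) x *\<^sub>R f x) = (\<lambda>x. indicator (\<Union>i\<in>J. A i) x *\<^sub>R f x)"
    by (simp add: indicator_UN_disjoint[OF J] scaleR_left.sum)
  finally show ?thesis
    using A J(1) by (subst L2_space_restrict_space_iff) auto
qed

text \<open>The hypothesis says that the image of \<open>M\<close> under \<open>\<pi>\<close> is at most \<open>K\<close> times \<open>N\<close>, and integrals are
  monotone in the measure.\<close>

lemma L2_space_compose:
  fixes f :: "'c \<Rightarrow> 'b::euclidean_space"
  assumes \<pi>: "\<pi> \<in> measurable M N" and f: "f \<in> L2_space N"
    and distort: "\<And>E. E \<in> sets N \<Longrightarrow> emeasure M (\<pi> -` E \<inter> space M) \<le> ennreal K * emeasure N E"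
  shows "(\<lambda>x. f (\<pi> x)) \<in> L2_space M"
proof -
  have f_meas: "f \<in> borel_measurable N" and fin: "(\<integral>\<^sup>+y. ennreal ((norm (f y))\<^sup>2) \<partial>N) < top"
    using f by (simp_all add: L2_space_iff)
  have meas: "(\<lambda>y. ennreal ((norm (f y))\<^sup>2)) \<in> borel_measurable N"
    using f_meas by measurable
  have "distr M N \<pi> \<le> scale_measure (ennreal K) N"
    using \<pi> distort by (subst le_measure) (auto simp: emeasure_distr)
  then have "(\<integral>\<^sup>+y. ennreal ((norm (f y))\<^sup>2) \<partial>distr M N \<pi>)
      \<le> (\<integral>\<^sup>+y. ennreal ((norm (f y))\<^sup>2) \<partial>scale_measure (ennreal K) N)"
    by (intro nn_integral_mono_measure) auto
  also have "\<dots> = ennreal K * (\<integral>\<^sup>+y. ennreal ((norm (f y))\<^sup>2) \<partial>N)"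
    using meas by (rule nn_integral_scale_measure)
  also have "\<dots> < top" using fin by (simp add: ennreal_mult_less_top)
  finally show ?thesis
    using \<pi> f_meas meas by (simp add: L2_space_iff nn_integral_distr)
qed

section \<open>Square integrability of the jump\<close>

text \<open>A common point of two interfaces lies in the closures of two subdomains that are not neighbours.\<close>

lemma iface_index_unique:
  assumes dec: "layered_decomposition \<Omega> I Om \<Gamma>D \<Gamma>N"
    and x: "x \<in> iface I Om i" "x \<in> iface I Om j"
  shows "i = j"
proof -
  have no_overlap: "\<not> i < j" if "x \<in> iface I Om i" "x \<in> iface I Om j" for i j
  proof
    assume "i < j"
    have ij: "i \<in> {1..I}" "Suc j \<in> {1..I}"
      and mem: "x \<in> closure (Om i) \<inter> closure (Om (Suc j))"
      using that by (auto simp: iface_def split: if_splits)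
    have "\<forall>i\<in>{1..I}. \<forall>j\<in>{1..I}. i < j \<longrightarrow>
        (closure (Om i) \<inter> closure (Om j) \<noteq> {} \<longleftrightarrow> j = Suc i)"
      using dec unfolding layered_decomposition_def by (elim conjE)
    then have "closure (Om i) \<inter> closure (Om (Suc j)) \<noteq> {} \<longleftrightarrow> Suc j = Suc i"
      using ij \<open>i < j\<close> by (meson less_SucI)
    then show False using mem \<open>i < j\<close> by auto
  qed
  show ?thesis
    using no_overlap[OF x] no_overlap[OF x(2,1)] by simp
qed

lemma iface_index_eq:
  assumes "layered_decomposition \<Omega> I Om \<Gamma>D \<Gamma>N" "x \<in> iface I Om i"
  shows "iface_index I Om x = i"
  unfolding iface_index_def
  by (rule the_equality[where P="\<lambda>j. x \<in> iface I Om j", OF assms(2)])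
    (rule iface_index_unique[OF assms(1) _ assms(2)])

text \<open>The values on the boundary of a representative are its trace, which is square integrable
  componentwise.\<close>

lemma L2_space_boundary_values:
  fixes v :: "nat \<Rightarrow> 'a::euclidean_space \<Rightarrow> 'a"
  assumes "v \<in> H_space I Om" "i \<in> {1..I}"
  shows "v i \<in> L2_space (surf_on (frontier (Om i)))"
proof -
  have "(\<lambda>x. v i x \<bullet> b) \<in> L2_space (surf_on (frontier (Om i)))" if "b \<in> Basis" for b
    using assms that by (simp add: H_space_def H1_vec_def is_trace_def)
  then have "(\<lambda>x. \<Sum>b\<in>Basis. (v i x \<bullet> b) *\<^sub>R b) \<in> L2_space (surf_on (frontier (Om i)))"
    by (intro L2_space_sum L2_space_scaleR)
  then show ?thesis by (simp add: euclidean_representation)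
qed

text \<open>The interfaces are disjoint, so a function given by a separate formula on each of them is a finite
  sum of its restrictions.\<close>

lemma L2_space_fault_piecewise:
  fixes v :: "nat \<Rightarrow> 'a::euclidean_space \<Rightarrow> 'a"
  assumes dec: "layered_decomposition \<Omega> I Om \<Gamma>D \<Gamma>N"
    and v: "\<And>i. i \<in> {1..<I} \<Longrightarrow> w i \<in> L2_space (surf_on (iface I Om i))"
  shows "(\<lambda>x. w (iface_index I Om x) x) \<in> L2_space (surf_on (fault I Om))"
  unfolding fault_def
proof (rule L2_space_restrict_space_UN)
  show "disjoint_family_on (iface I Om) {1..<I}"
    using iface_index_unique[OF dec] by (auto simp: disjoint_family_on_def)
  fix i assume i: "i \<in> {1..<I}"
  show "iface I Om i \<in> sets surf" by (intro closed_sets_surf closed_iface)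
  show "(\<lambda>x. w (iface_index I Om x) x) \<in> L2_space (surf_on (iface I Om i))"
    using v[OF i] iface_index_eq[OF dec]
    by (subst L2_space_cong[where g="w i"]) (auto simp: space_restrict_space)
qed simp

lemma L2_space_traces:
  fixes v :: "nat \<Rightarrow> 'a::euclidean_space \<Rightarrow> 'a"
  assumes dec: "layered_decomposition \<Omega> I Om \<Gamma>D \<Gamma>N" and v: "v \<in> H_space I Om"
  shows "bottom_trace I Om v \<in> L2_space (surf_on (fault I Om))"
    and "top_trace I Om v \<in> L2_space (surf_on (fault I Om))"
proof -
  have "v j \<in> L2_space (surf_on (iface I Om i))"
    if "i \<in> {1..<I}" "j = i \<or> j = Suc i" for i j
  proof (rule L2_space_restrict_space_subset)
    show "v j \<in> L2_space (surf_on (frontier (Om j)))"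
      using that by (intro L2_space_boundary_values[OF v]) auto
    show "iface I Om i \<subseteq> frontier (Om j)"
      using that iface_subset_frontier[OF dec that(1)] by auto
  qed (auto intro!: closed_sets_surf closed_iface)
  then show "bottom_trace I Om v \<in> L2_space (surf_on (fault I Om))"
    and "top_trace I Om v \<in> L2_space (surf_on (fault I Om))"
    using L2_space_fault_piecewise[OF dec, of v] L2_space_fault_piecewise[OF dec, of "\<lambda>i. v (Suc i)"]
    by (simp_all add: bottom_trace_def[abs_def] top_trace_def[abs_def])
qed

lemma L2_space_jump:
  fixes v :: "nat \<Rightarrow> 'a::euclidean_space \<Rightarrow> 'a"
  assumes dec: "layered_decomposition \<Omega> I Om \<Gamma>D \<Gamma>N" and v: "v \<in> H_space I Om"
    and reg: "regular_contact I Om u"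
  shows "jump I Om u v \<in> L2_space (surf_on (contact_bottom I Om u))"
proof -
  let ?B = "contact_bottom I Om u" and ?T = "contact_top I Om u" and ?\<pi> = "contact_map I Om u"
  have B: "?B \<in> sets surf" and T: "?T \<in> sets surf"
    and \<pi>: "?\<pi> \<in> measurable (surf_on ?B) (surf_on ?T)"
    using reg unfolding regular_contact_def Let_def by auto
  obtain K :: real where K: "\<And>A. A \<in> sets surf \<Longrightarrow> A \<subseteq> ?B \<Longrightarrow>
      emeasure surf A \<le> ennreal K * emeasure surf (?\<pi> ` A)"
    using reg unfolding regular_contact_def Let_def by auto
  have sub: "?B \<subseteq> fault I Om" "?T \<subseteq> fault I Om"
    by (auto simp: contact_bottom_def contact_top_def)
  have fault: "fault I Om \<in> sets surf" by (intro closed_sets_surf closed_fault)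
  have "(\<lambda>x. top_trace I Om v (?\<pi> x)) \<in> L2_space (surf_on ?B)"
  proof (rule L2_space_compose[OF \<pi>])
    show "top_trace I Om v \<in> L2_space (surf_on ?T)"
      by (rule L2_space_restrict_space_subset[OF L2_space_traces(2)[OF dec v] fault T sub(2)])
    fix E assume E: "E \<in> sets (surf_on ?T)"
    have "E \<in> sets surf" "E \<subseteq> ?T" using E T by (simp_all add: sets_restrict_space_iff)
    define A where "A = ?\<pi> -` E \<inter> space (surf_on ?B)"
    have "A \<in> sets (surf_on ?B)" unfolding A_def by (rule measurable_sets[OF \<pi> E])
    then have A: "A \<in> sets surf" "A \<subseteq> ?B" using B by (simp_all add: sets_restrict_space_iff)
    have "emeasure (surf_on ?B) A = emeasure surf A"
      using A B by (intro emeasure_restrict_space) auto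
    also have "\<dots> \<le> ennreal K * emeasure surf (?\<pi> ` A)" by (rule K[OF A])
    also have "\<dots> \<le> ennreal K * emeasure surf E"
      using \<open>E \<in> sets surf\<close> by (intro mult_left_mono emeasure_mono) (auto simp: A_def)
    also have "emeasure surf E = emeasure (surf_on ?T) E"
      using T \<open>E \<subseteq> ?T\<close> by (intro emeasure_restrict_space[symmetric]) auto
    finally show "emeasure (surf_on ?B) (?\<pi> -` E \<inter> space (surf_on ?B)) \<le> ennreal K * emeasure (surf_on ?T) E"
      by (simp add: A_def)
  qed
  moreover have "bottom_trace I Om v \<in> L2_space (surf_on ?B)"
    by (rule L2_space_restrict_space_subset[OF L2_space_traces(1)[OF dec v] fault B sub(1)])
  ultimately show ?thesis
    using L2_space_diff by (simp add: jump_def[abs_def])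
qed

section \<open>Integration of pointwise variational inequalities\<close>

text \<open>With an integrable negative part the extended integral is the Lebesgue integral or infinity, so
  the case distinction of the variational inequality is one on integrability.\<close>

lemma ext_integral_cases:
  assumes f: "f \<in> borel_measurable M" and neg: "(\<integral>\<^sup>+x. ennreal (- f x) \<partial>M) < top"
  obtains (finite) "integrable M f" "ext_integral M f = ereal (\<integral>x. f x \<partial>M)"
    | (infinite) "\<not> integrable M f" "ext_integral M f = \<infinity>"
proof (cases "(\<integral>\<^sup>+x. ennreal (f x) \<partial>M) = top")
  case True
  have "\<not> integrable M f" using True by (auto simp: real_integrable_def)
  moreover have "ext_integral M f = \<infinity>"
    using neg unfolding ext_integral_def True
    by (cases "\<integral>\<^sup>+x. ennreal (- f x) \<partial>M") (auto simp: enn2ereal_ennreal)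
  ultimately show ?thesis by (rule infinite)
next
  case False
  have int: "integrable M f" using f neg False by (auto simp: real_integrable_def)
  obtain r q where "0 \<le> r" "(\<integral>\<^sup>+x. ennreal (f x) \<partial>M) = ennreal r"
    "0 \<le> q" "(\<integral>\<^sup>+x. ennreal (- f x) \<partial>M) = ennreal q"
    using neg False by (metis less_top_ennreal less_top)
  moreover have "(\<integral>x. f x \<partial>M) = enn2real (\<integral>\<^sup>+x. ennreal (f x) \<partial>M) - enn2real (\<integral>\<^sup>+x. ennreal (- f x) \<partial>M)"
    by (rule real_lebesgue_integral_def[OF int])
  ultimately have "ext_integral M f = ereal (\<integral>x. f x \<partial>M)"
    by (simp add: ext_integral_def enn2ereal_ennreal)
  with int show ?thesis by (rule finite)
qed

lemma ext_integral_restrict_space: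
  assumes "A \<inter> space M \<in> sets M"
  shows "ext_integral (restrict_space M A) f = ext_integral M (\<lambda>x. indicator A x * f x)"
proof -
  have "ennreal (g x) * indicator A x = ennreal (indicator A x * g x)" for g :: "'a \<Rightarrow> real" and x
    by (simp add: indicator_def)
  from this[of f] this[of "\<lambda>x. - f x"] show ?thesis
    by (simp add: ext_integral_def nn_integral_restrict_space[OF assms])
qed

text \<open>For a proper convex \<open>J\<close> the inequality says that \<open>\<alpha>\<close> is the value at \<open>p\<close> of the proximal map of
  \<open>\<tau> J\<close> in \<open>L\<^sup>2(M)\<close>, that is, the minimiser of \<open>\<parallel>\<beta> - p\<parallel>\<^sup>2 / 2 + \<tau> J(\<beta>)\<close> over \<open>\<beta>\<close>.\<close>

definition solves_proximal_inequality ::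
    "'a measure \<Rightarrow> real \<Rightarrow> (('a \<Rightarrow> real) \<Rightarrow> ereal) \<Rightarrow> ('a \<Rightarrow> real) \<Rightarrow> ('a \<Rightarrow> real) \<Rightarrow> bool" where
  "solves_proximal_inequality M \<tau> J p \<alpha> \<longleftrightarrow>
     \<alpha> \<in> L2_space M \<and>
     (\<forall>\<beta>\<in>L2_space M.
        ereal (L2_inner M \<alpha> (\<lambda>x. \<beta> x - \<alpha> x)) + ereal \<tau> * J \<beta> - ereal \<tau> * J \<alpha>
          \<ge> ereal (L2_inner M p (\<lambda>x. \<beta> x - \<alpha> x)))"

text \<open>The inequality for \<open>a\<close> is its pointwise form integrated where the functional is finite at \<open>\<beta>\<close>, and
  holds trivially where it is infinite, because the functional is finite at \<open>a\<close>. A second solution has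
  a finite functional too, as its inequality tested with \<open>a\<close> would fail otherwise. So the two solutions
  can be tested with each other.\<close>

lemma proximal_inequality_from_pointwise:
  fixes G :: "'a \<Rightarrow> real \<Rightarrow> real" and p a :: "'a \<Rightarrow> real"
  assumes \<tau>: "\<tau> > 0" and p: "p \<in> L2_space M" and a: "a \<in> L2_space M"
    and J: "\<And>\<beta>. \<beta> \<in> L2_space M \<Longrightarrow> J \<beta> = ext_integral M (\<lambda>x. G x (\<beta> x))"
    and meas: "\<And>\<beta>. \<beta> \<in> L2_space M \<Longrightarrow> (\<lambda>x. G x (\<beta> x)) \<in> borel_measurable M"
    and neg: "\<And>\<beta>. \<beta> \<in> L2_space M \<Longrightarrow> (\<integral>\<^sup>+x. ennreal (- G x (\<beta> x)) \<partial>M) < top"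
    and zero: "integrable M (\<lambda>x. G x 0)"
    and prox: "\<And>x b. x \<in> space M \<Longrightarrow> 0 \<le> (a x - p x) * (b - a x) + \<tau> * (G x b - G x (a x))"
  shows "solves_proximal_inequality M \<tau> J p a"
    and "solves_proximal_inequality M \<tau> J p a' \<Longrightarrow> AE x in M. a' x = a x"
proof -
  have inner: "L2_inner M f (\<lambda>x. \<beta> x - f x) - L2_inner M p (\<lambda>x. \<beta> x - f x)
      = (\<integral>x. (f x - p x) * (\<beta> x - f x) \<partial>M)"
    if "f \<in> L2_space M" "\<beta> \<in> L2_space M" for f \<beta>
    unfolding L2_inner_def
    by (subst Bochner_Integration.integral_diff[symmetric])
      (auto intro!: L2_space_integrable_mult L2_space_diff that p simp: left_diff_distrib)
  (* Testing with 0 bounds the density at a from above by an integrable function. *)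
  have Ga: "integrable M (\<lambda>x. G x (a x))"
  proof -
    have "(\<integral>\<^sup>+x. ennreal (G x (a x)) \<partial>M)
        \<le> (\<integral>\<^sup>+x. ennreal (norm (G x 0 + (a x - p x) * (- a x) / \<tau>)) \<partial>M)"
    proof (intro nn_integral_mono ennreal_leI)
      fix x assume "x \<in> space M"
      have "\<tau> * (G x 0 + (a x - p x) * (- a x) / \<tau>) = \<tau> * G x 0 + (a x - p x) * (- a x)"
        using \<tau> by (simp add: right_diff_distrib)
      moreover have "0 \<le> (a x - p x) * (- a x) + (\<tau> * G x 0 - \<tau> * G x (a x))"
        using prox[OF \<open>x \<in> space M\<close>, of 0] by (simp add: right_diff_distrib)
      ultimately have "\<tau> * G x (a x) \<le> \<tau> * (G x 0 + (a x - p x) * (- a x) / \<tau>)"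
        by linarith
      then have "G x (a x) \<le> G x 0 + (a x - p x) * (- a x) / \<tau>"
        using \<tau> by simp
      then show "G x (a x) \<le> norm (G x 0 + (a x - p x) * (- a x) / \<tau>)"
        by simp
    qed
    also have "\<dots> < top"
    proof -
      have "integrable M (\<lambda>x. G x 0 + (a x - p x) * (- a x) / \<tau>)"
        using zero a p by (intro Bochner_Integration.integrable_add integrable_divide
            L2_space_integrable_mult L2_space_diff L2_space_minus)
      then show ?thesis by (simp add: integrable_iff_bounded)
    qed
    finally show ?thesis
      using neg[OF a] meas[OF a] by (auto simp: real_integrable_def)
  qed
  then have Ja: "J a = ereal (\<integral>x. G x (a x) \<partial>M)"
    using ext_integral_cases[OF meas[OF a] neg[OF a]] J[OF a] by metis
  have gap: "0 \<le> (\<integral>x. (a x - p x) * (\<beta> x - a x) \<partial>M)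
      + \<tau> * ((\<integral>x. G x (\<beta> x) \<partial>M) - (\<integral>x. G x (a x) \<partial>M))"
    if \<beta>: "\<beta> \<in> L2_space M" and int: "integrable M (\<lambda>x. G x (\<beta> x))" for \<beta>
  proof -
    have int': "integrable M (\<lambda>x. (a x - p x) * (\<beta> x - a x))"
      by (intro L2_space_integrable_mult L2_space_diff a p \<beta>)
    have "0 \<le> (\<integral>x. (a x - p x) * (\<beta> x - a x) + \<tau> * (G x (\<beta> x) - G x (a x)) \<partial>M)"
      using prox by (intro integral_nonneg_AE) auto
    also have "\<dots> = (\<integral>x. (a x - p x) * (\<beta> x - a x) \<partial>M)
      + \<tau> * ((\<integral>x. G x (\<beta> x) \<partial>M) - (\<integral>x. G x (a x) \<partial>M))"
      using int int' Ga by simp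
    finally show ?thesis .
  qed
  show "solves_proximal_inequality M \<tau> J p a"
    unfolding solves_proximal_inequality_def
  proof (intro conjI ballI a)
    fix \<beta> :: "'a \<Rightarrow> real" assume \<beta>: "\<beta> \<in> L2_space M"
    show "ereal (L2_inner M p (\<lambda>x. \<beta> x - a x))
        \<le> ereal (L2_inner M a (\<lambda>x. \<beta> x - a x)) + ereal \<tau> * J \<beta> - ereal \<tau> * J a"
      using meas[OF \<beta>] neg[OF \<beta>]
    proof (cases rule: ext_integral_cases)
      case finite
      then show ?thesis
        using gap[OF \<beta>] inner[OF a \<beta>] J[OF \<beta>] Ja by (simp add: algebra_simps)
    next
      case infinite
      then show ?thesis using J[OF \<beta>] Ja \<tau> by simp
    qed
  qed
  assume a': "solves_proximal_inequality M \<tau> J p a'"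
  then have L2': "a' \<in> L2_space M"
    and ineq: "\<And>\<beta>. \<beta> \<in> L2_space M \<Longrightarrow> ereal (L2_inner M p (\<lambda>x. \<beta> x - a' x))
        \<le> ereal (L2_inner M a' (\<lambda>x. \<beta> x - a' x)) + ereal \<tau> * J \<beta> - ereal \<tau> * J a'"
    by (auto simp: solves_proximal_inequality_def)
  show "AE x in M. a' x = a x"
    using meas[OF L2'] neg[OF L2']
  proof (cases rule: ext_integral_cases)
    case infinite
    then show ?thesis using ineq[OF a] J[OF L2'] Ja \<tau> by simp
  next
    case finite
    have "0 \<le> (\<integral>x. (a' x - p x) * (a x - a' x) \<partial>M)
        + \<tau> * ((\<integral>x. G x (a x) \<partial>M) - (\<integral>x. G x (a' x) \<partial>M))"
      using ineq[OF a] inner[OF L2' a] J[OF L2'] Ja finite(2) by (simp add: algebra_simps)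
    (* Adding the inequality of a tested with a' cancels the functional. *)
    with gap[OF L2' finite(1)] have "0 \<le> (\<integral>x. (a' x - p x) * (a x - a' x) \<partial>M)
        + (\<integral>x. (a x - p x) * (a' x - a x) \<partial>M)"
      by (simp add: algebra_simps)
    also have "\<dots> = (\<integral>x. (a' x - p x) * (a x - a' x) + (a x - p x) * (a' x - a x) \<partial>M)"
      by (intro Bochner_Integration.integral_add[symmetric] L2_space_integrable_mult L2_space_diff a p L2')
    also have "\<dots> = (\<integral>x. - ((a' x - a x) * (a' x - a x)) \<partial>M)"
      by (intro Bochner_Integration.integral_cong) (auto simp: algebra_simps)
    finally have "(\<integral>x. (a' x - a x) * (a' x - a x) \<partial>M) \<le> 0" by simp
    moreover have "0 \<le> (\<integral>x. (a' x - a x) * (a' x - a x) \<partial>M)" by simp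
    ultimately have "(\<integral>x. (a' x - a x) * (a' x - a x) \<partial>M) = 0" by simp
    moreover have "integrable M (\<lambda>x. (a' x - a x) * (a' x - a x))"
      by (intro L2_space_integrable_mult L2_space_diff a L2')
    ultimately have "AE x in M. (a' x - a x) * (a' x - a x) = 0"
      by (simp add: integral_nonneg_eq_0_iff_AE)
    then show ?thesis by eventually_elim simp
  qed
qed

section \<open>Pointwise solutions for the two laws\<close>

lemma nn_integral_less_top_if_bounded_by_integrable:
  fixes f g :: "'a \<Rightarrow> real"
  assumes "integrable M g" "\<And>x. x \<in> space M \<Longrightarrow> f x \<le> g x"
  shows "(\<integral>\<^sup>+x. ennreal (f x) \<partial>M) < top"
proof -
  have "(\<integral>\<^sup>+x. ennreal (f x) \<partial>M) \<le> (\<integral>\<^sup>+x. ennreal (norm (g x)) \<partial>M)"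
    unfolding real_norm_def
    by (intro nn_integral_mono ennreal_leI order_trans[OF assms(2) abs_ge_self])
  also have "\<dots> < top" using assms(1) by (simp add: integrable_iff_bounded)
  finally show ?thesis .
qed

text \<open>The function \<open>r\<close> is the inverse of the strictly increasing bijection \<open>y \<mapsto> y - \<tau> e\<^bsup>-y\<^esup>\<close>, hence
  increasing, hence a Borel function. This provides a measurable choice of the pointwise solutions for
  Dieterich's law.\<close>

lemma exponential_resolvent:
  assumes "\<tau> > (0::real)"
  obtains r :: "real \<Rightarrow> real"
  where "\<And>q. r q - q = \<tau> * exp (- r q)" "\<And>q. \<bar>r q\<bar> \<le> \<bar>q\<bar> + \<tau>" "r \<in> borel_measurable borel"
proof -
  define h where "h y = y - \<tau> * exp (- y)" for y :: real
  have h_less: "h y < h y'" if "y < y'" for y y'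
  proof -
    have "\<tau> * exp (- y') < \<tau> * exp (- y)" using that assms by simp
    then show ?thesis using that by (simp add: h_def)
  qed
  have "\<exists>y. h y = q" for q
  proof -
    have "\<tau> * exp (- (\<bar>q\<bar> + \<tau>)) \<le> \<tau> * 1" using assms by (intro mult_left_mono) auto
    then have "q \<le> h (\<bar>q\<bar> + \<tau>)" unfolding h_def by linarith
    moreover have "h q \<le> q" using assms by (simp add: h_def)
    moreover have "continuous_on {q..\<bar>q\<bar> + \<tau>} h"
      unfolding h_def by (intro continuous_intros)
    ultimately show ?thesis
      using IVT'[of h q q "\<bar>q\<bar> + \<tau>"] assms by fastforce
  qed
  then obtain r where r: "\<And>q. h (r q) = q" by metis
  have "mono r"
  proof (rule monoI, rule ccontr)
    fix q q' :: real assume "q \<le> q'" "\<not> r q \<le> r q'"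
    then show False using h_less[of "r q'" "r q"] by (simp add: r)
  qed
  then have "r \<in> borel_measurable borel" by (rule borel_measurable_mono)
  moreover have "r q - q = \<tau> * exp (- r q)" for q using r[of q] by (simp add: h_def)
  moreover have "\<bar>r q\<bar> \<le> \<bar>q\<bar> + \<tau>" for q
  proof (cases "0 \<le> r q")
    case True
    then have "\<tau> * exp (- r q) \<le> \<tau> * 1" using assms by (intro mult_left_mono) auto
    then show ?thesis using True r[of q] by (simp add: h_def)
  next
    case False
    moreover have "0 < \<tau> * exp (- r q)" using assms by simp
    ultimately show ?thesis using r[of q] assms unfolding h_def by linarith
  qed
  ultimately show ?thesis using that by blast
qed

text \<open>Here \<open>s\<close> is \<open>V / L\<close>. The pointwise equation is \<open>a - \<tau> e\<^bsup>-a\<^esup> = p - \<tau> s\<close>, and the gap in the pointwise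
  inequality is \<open>\<tau> e\<^bsup>-a\<^esup> (e\<^bsup>a-b\<^esup> - 1 - (a - b))\<close>. The measure has to be finite because the functional
  at \<open>\<beta> = 0\<close> is the measure of \<open>B\<close>.\<close>

lemma dieterich_state_problem_solvable:
  fixes s p :: "'a \<Rightarrow> real"
  assumes M: "finite_measure M" and B: "B \<in> sets M" and \<tau>: "\<tau> > 0"
    and s: "s \<in> L2_space M" and p: "p \<in> L2_space M"
    and s_nonneg: "\<And>x. 0 \<le> s x"
    and J: "\<And>\<beta>. \<beta> \<in> L2_space M \<Longrightarrow>
      J \<beta> = ext_integral M (\<lambda>x. indicator B x * (s x * \<beta> x + exp (- \<beta> x)))"
  shows "\<exists>a. solves_proximal_inequality M \<tau> J p a \<and>
           (\<forall>a'. solves_proximal_inequality M \<tau> J p a' \<longrightarrow> (AE x in M. a' x = a x))"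
proof -
  obtain r where r: "\<And>q. r q - q = \<tau> * exp (- r q)" "\<And>q. \<bar>r q\<bar> \<le> \<bar>q\<bar> + \<tau>"
    and r_meas [measurable]: "r \<in> borel_measurable borel"
    using exponential_resolvent[OF \<tau>] by blast
  note [measurable] = L2_spaceD[OF s] L2_spaceD[OF p] B
  define a where "a x = (if x \<in> B then r (p x - \<tau> * s x) else p x)" for x
  have "(\<lambda>x. (norm (p x) + \<tau> * s x) + \<tau>) \<in> L2_space M"
    by (intro L2_space_add L2_space_norm L2_space_cmult L2_space_const s p M)
  then have a: "a \<in> L2_space M"
  proof (rule L2_space_dominated)
    show "a \<in> borel_measurable M" unfolding a_def by measurable
    fix x
    have "0 \<le> \<tau> * s x" using \<tau> s_nonneg by simp
    then show "norm (a x) \<le> norm ((norm (p x) + \<tau> * s x) + \<tau>)"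
      using r(2)[of "p x - \<tau> * s x"] \<tau> by (auto simp: a_def)
  qed
  have prox: "0 \<le> (a x - p x) * (b - a x)
      + \<tau> * (indicator B x * (s x * b + exp (- b)) - indicator B x * (s x * a x + exp (- a x)))" for x b
  proof (cases "x \<in> B")
    case True
    have e1: "a x - p x = \<tau> * (exp (- a x) - s x)"
      using r(1)[of "p x - \<tau> * s x"] True by (simp add: a_def algebra_simps)
    have e2: "exp (- b) = exp (- a x) * exp (a x - b)"
      by (simp add: exp_add[symmetric])
    have "(a x - p x) * (b - a x)
        + \<tau> * ((s x * b + exp (- b)) - (s x * a x + exp (- a x)))
      = \<tau> * exp (- a x) * (exp (a x - b) - (1 + (a x - b)))"
      unfolding e1 e2 by (simp add: algebra_simps)
    also have "0 \<le> \<dots>"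
      using \<tau> exp_ge_add_one_self[of "a x - b"] by simp
    finally show ?thesis using True by simp
  qed (simp add: a_def)
  have neg: "(\<integral>\<^sup>+x. ennreal (- (indicator B x * (s x * \<beta> x + exp (- \<beta> x)))) \<partial>M) < top"
    if \<beta>: "\<beta> \<in> L2_space M" for \<beta>
  proof (rule nn_integral_less_top_if_bounded_by_integrable)
    show "integrable M (\<lambda>x. norm (s x * \<beta> x))"
      by (intro integrable_norm L2_space_integrable_mult s \<beta>)
    show "- (indicator B x * (s x * \<beta> x + exp (- \<beta> x))) \<le> norm (s x * \<beta> x)" for x
    proof -
      have "0 < exp (- \<beta> x)" by simp
      then have "- (s x * \<beta> x + exp (- \<beta> x)) \<le> \<bar>s x * \<beta> x\<bar>" by linarith
      then show ?thesis by (simp add: indicator_def)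
    qed
  qed
  have meas: "(\<lambda>x. indicator B x * (s x * \<beta> x + exp (- \<beta> x))) \<in> borel_measurable M"
    if "\<beta> \<in> L2_space M" for \<beta>
    using L2_spaceD[OF that] by measurable
  have zero: "integrable M (\<lambda>x. indicator B x * (s x * 0 + exp (- 0)))"
    using finite_measure.emeasure_finite[OF M] B by (simp add: less_top)
  show ?thesis
    using proximal_inequality_from_pointwise[OF \<tau> p a J meas neg zero prox] by blast
qed

lemma mult_abs_ln_le:
  fixes s :: real
  assumes "0 \<le> s"
  shows "s \<le> 1 \<Longrightarrow> s * \<bar>ln s\<bar> \<le> 1" "1 \<le> s \<Longrightarrow> \<bar>ln s\<bar> \<le> s"
proof -
  assume "s \<le> 1"
  show "s * \<bar>ln s\<bar> \<le> 1"
  proof (cases "s = 0")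
    case False
    then have "0 < s" using assms by simp
    have "- ln s \<le> 1 / s - 1"
      using ln_le_minus_one[of "1 / s"] \<open>0 < s\<close> by (simp add: ln_div)
    then have "s * (- ln s) \<le> s * (1 / s - 1)" using assms by (rule mult_left_mono)
    also have "\<dots> \<le> 1" using \<open>0 < s\<close> by (simp add: right_diff_distrib)
    finally show ?thesis using \<open>0 < s\<close> \<open>s \<le> 1\<close> by simp
  qed simp
next
  assume "1 \<le> s"
  then show "\<bar>ln s\<bar> \<le> s" using ln_le_minus_one[of s] by simp
qed

text \<open>Apply the bounds for \<open>s \<bar>ln s\<bar>\<close> to the square root of \<open>s\<close>.\<close>

lemma mult_ln_square_le:
  fixes s :: real
  assumes "0 \<le> s"
  shows "s * (ln s)\<^sup>2 \<le> 4 * (s\<^sup>2 + 1)"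
proof (cases "s = 0")
  case False
  then have "0 < s" using assms by simp
  define t where "t = sqrt s"
  have t: "0 < t" "s = t\<^sup>2" using \<open>0 < s\<close> by (auto simp: t_def)
  have s_ln: "s * (ln s)\<^sup>2 = 4 * (t * \<bar>ln t\<bar>)\<^sup>2"
    using t by (simp add: ln_realpow power_mult_distrib)
  show ?thesis
  proof (cases "t \<le> 1")
    case True
    have "t * \<bar>ln t\<bar> \<le> 1" using t True by (intro mult_abs_ln_le(1)) auto
    moreover have "0 \<le> t * \<bar>ln t\<bar>" using t by (intro mult_nonneg_nonneg) auto
    ultimately have "(t * \<bar>ln t\<bar>)\<^sup>2 \<le> 1\<^sup>2" by (rule power_mono)
    then have "s * (ln s)\<^sup>2 \<le> 4 * 1" unfolding s_ln by (simp only: power_one)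
    also have "\<dots> \<le> 4 * (s\<^sup>2 + 1)" by simp
    finally show ?thesis .
  next
    case False
    then have "(t * \<bar>ln t\<bar>)\<^sup>2 \<le> (t * t)\<^sup>2"
      using t mult_abs_ln_le(2)[of t] by (intro power_mono mult_left_mono) auto
    also have "\<dots> = s\<^sup>2" using t by (simp add: power2_eq_square)
    finally show ?thesis unfolding s_ln by simp
  qed
qed simp

text \<open>Here \<open>s\<close> is \<open>V / L\<close>. The law is quadratic in the state, so the pointwise equation
  \<open>a + \<tau> s (a + ln s) = p\<close> is linear, and the gap in the pointwise inequality is \<open>\<tau> s (b - a)\<^sup>2 / 2\<close>.
  The factor \<open>s\<close> compensates the singularity of \<open>ln s\<close> at \<open>s = 0\<close>. For large \<open>s\<close> the logarithm is
  dominated by \<open>s\<close>, and the denominator \<open>1 + \<tau> s\<close> keeps the solution of linear growth.\<close>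

lemma ruina_state_problem_solvable:
  fixes s p :: "'a \<Rightarrow> real"
  assumes M: "finite_measure M" and B: "B \<in> sets M" and \<tau>: "\<tau> > 0"
    and s: "s \<in> L2_space M" and p: "p \<in> L2_space M"
    and s_nonneg: "\<And>x. 0 \<le> s x"
    and J: "\<And>\<beta>. \<beta> \<in> L2_space M \<Longrightarrow>
      J \<beta> = ext_integral M (\<lambda>x. indicator B x * (s x * (1 / 2 * (\<beta> x)\<^sup>2 + ln (s x) * \<beta> x)))"
  shows "\<exists>a. solves_proximal_inequality M \<tau> J p a \<and>
           (\<forall>a'. solves_proximal_inequality M \<tau> J p a' \<longrightarrow> (AE x in M. a' x = a x))"
proof -
  note [measurable] = L2_spaceD[OF s] L2_spaceD[OF p] B
  define a where
    "a x = (if x \<in> B then (p x - \<tau> * s x * ln (s x)) / (1 + \<tau> * s x) else p x)" for x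
  have pos: "0 < 1 + \<tau> * s x" for x using \<tau> s_nonneg[of x] by (simp add: add_pos_nonneg)
  have bound: "\<bar>a x\<bar> \<le> \<bar>p x\<bar> + s x + \<tau>" for x
  proof (cases "x \<in> B")
    case True
    let ?m = "\<tau> * s x"
    have m: "0 \<le> ?m" using \<tau> s_nonneg[of x] by simp
    have "?m * \<bar>ln (s x)\<bar> \<le> (s x + \<tau>) * (1 + ?m)"
    proof (cases "s x \<le> 1")
      case True
      have "?m * \<bar>ln (s x)\<bar> \<le> \<tau>"
        using mult_abs_ln_le(1)[OF s_nonneg True] \<tau> by (simp add: mult.assoc mult_left_le)
      also have "\<dots> \<le> (s x + \<tau>) * (1 + ?m)"
        using m s_nonneg[of x] \<tau> by (simp add: algebra_simps)
      finally show ?thesis .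
    next
      case False
      then have "?m * \<bar>ln (s x)\<bar> \<le> ?m * s x"
        using mult_abs_ln_le(2)[OF s_nonneg] m by (intro mult_left_mono) auto
      also have "\<dots> \<le> (s x + \<tau>) * (1 + ?m)"
        using m s_nonneg[of x] \<tau> by (simp add: algebra_simps)
      finally show ?thesis .
    qed
    moreover have "\<bar>p x\<bar> \<le> \<bar>p x\<bar> * (1 + ?m)"
      using m mult_left_mono[of 1 "1 + ?m" "\<bar>p x\<bar>"] by simp
    moreover have "\<bar>p x - ?m * ln (s x)\<bar> \<le> \<bar>p x\<bar> + ?m * \<bar>ln (s x)\<bar>"
      using abs_triangle_ineq4[of "p x" "?m * ln (s x)"] abs_mult[of ?m "ln (s x)"] abs_of_nonneg[OF m]
      by (simp only:)
    ultimately have "\<bar>p x - ?m * ln (s x)\<bar> \<le> (\<bar>p x\<bar> + s x + \<tau>) * (1 + ?m)"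
      by (simp add: algebra_simps)
    then have "\<bar>p x - ?m * ln (s x)\<bar> / (1 + ?m) \<le> \<bar>p x\<bar> + s x + \<tau>"
      using pos[of x] by (simp only: pos_divide_le_eq)
    moreover have "\<bar>a x\<bar> = \<bar>p x - ?m * ln (s x)\<bar> / (1 + ?m)"
      using True pos[of x] by (simp add: a_def)
    ultimately show ?thesis by simp
  qed (use \<tau> s_nonneg[of x] in \<open>simp add: a_def\<close>)
  have "(\<lambda>x. (norm (p x) + s x) + \<tau>) \<in> L2_space M"
    by (intro L2_space_add L2_space_norm L2_space_const s p M)
  then have a: "a \<in> L2_space M"
  proof (rule L2_space_dominated)
    show "a \<in> borel_measurable M" unfolding a_def by measurable
    show "norm (a x) \<le> norm ((norm (p x) + s x) + \<tau>)" for x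
      using bound[of x] by simp
  qed
  have prox: "0 \<le> (a x - p x) * (b - a x)
      + \<tau> * (indicator B x * (s x * (1 / 2 * b\<^sup>2 + ln (s x) * b))
             - indicator B x * (s x * (1 / 2 * (a x)\<^sup>2 + ln (s x) * a x)))" for x b
  proof (cases "x \<in> B")
    case True
    have "a x * (1 + \<tau> * s x) = p x - \<tau> * s x * ln (s x)"
      using True pos[of x] by (simp add: a_def)
    then have p_eq: "p x = a x + \<tau> * s x * (a x + ln (s x))"
      by (simp add: algebra_simps)
    have "(a x - p x) * (b - a x)
        + \<tau> * (s x * (1 / 2 * b\<^sup>2 + ln (s x) * b) - s x * (1 / 2 * (a x)\<^sup>2 + ln (s x) * a x))
      = \<tau> * s x * (1 / 2 * (b - a x)\<^sup>2)"
      unfolding p_eq by (simp add: power2_eq_square field_simps)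
    also have "0 \<le> \<dots>" using \<tau> s_nonneg[of x] by simp
    finally show ?thesis using True by simp
  qed (simp add: a_def)
  have neg: "(\<integral>\<^sup>+x. ennreal (- (indicator B x * (s x * (1 / 2 * (\<beta> x)\<^sup>2 + ln (s x) * \<beta> x)))) \<partial>M) < top"
    if \<beta>: "\<beta> \<in> L2_space M" for \<beta>
  proof (rule nn_integral_less_top_if_bounded_by_integrable)
    show "integrable M (\<lambda>x. 2 * ((norm (s x))\<^sup>2 + 1))"
      using s by (intro integrable_mult_right Bochner_Integration.integrable_add
          finite_measure.integrable_const[OF M]) (simp add: L2_space_def)
    fix x
    (* Completing the square. *)
    have "- (s x * (1 / 2 * (\<beta> x)\<^sup>2 + ln (s x) * \<beta> x))
        = 1 / 2 * (s x * (ln (s x))\<^sup>2) - 1 / 2 * (s x * (\<beta> x + ln (s x))\<^sup>2)"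
      by (simp add: power2_eq_square field_simps)
    also have "\<dots> \<le> 1 / 2 * (s x * (ln (s x))\<^sup>2)" using s_nonneg[of x] by simp
    also have "\<dots> \<le> 2 * ((norm (s x))\<^sup>2 + 1)"
      using mult_ln_square_le[OF s_nonneg[of x]] by simp
    finally show "- (indicator B x * (s x * (1 / 2 * (\<beta> x)\<^sup>2 + ln (s x) * \<beta> x))) \<le> 2 * ((norm (s x))\<^sup>2 + 1)"
      by (simp add: indicator_def)
  qed
  have meas: "(\<lambda>x. indicator B x * (s x * (1 / 2 * (\<beta> x)\<^sup>2 + ln (s x) * \<beta> x))) \<in> borel_measurable M"
    if "\<beta> \<in> L2_space M" for \<beta>
    using L2_spaceD[OF that] by measurable
  have zero: "integrable M (\<lambda>x. indicator B x * (s x * (1 / 2 * 0\<^sup>2 + ln (s x) * 0)))"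
    by simp
  show ?thesis
    using proximal_inequality_from_pointwise[OF \<tau> p a J meas neg zero prox] by blast
qed

section \<open>The spatial state problem\<close>

theorem proposition3p3:
  fixes \<Omega> :: "(real ^ 'd) set"
    and I :: nat
    and Om \<Gamma>D \<Gamma>N :: "nat \<Rightarrow> (real ^ 'd) set"
    and N n :: nat
    and u :: "nat \<Rightarrow> nat \<Rightarrow> real ^ 'd \<Rightarrow> real ^ 'd"
    and \<alpha> :: "nat \<Rightarrow> real ^ 'd \<Rightarrow> real"
    and v :: "nat \<Rightarrow> real ^ 'd \<Rightarrow> real ^ 'd"
    and \<psi> :: "real \<Rightarrow> real \<Rightarrow> real"
    and \<tau> L :: real
  assumes dim: "CARD('d) \<in> {2, 3}"
    and decomposition: "layered_decomposition \<Omega> I Om \<Gamma>D \<Gamma>N"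
    and constants: "\<tau> > 0" "L > 0"
    and law: "\<psi> = dieterich_law L \<or> \<psi> = ruina_law L"
    and step: "n \<in> {1..N}"
    and deformation: "u (n - 1) \<in> H0_space I Om \<Gamma>D"
      "no_self_penetration I Om (u (n - 1))" "regular_contact I Om (u (n - 1))"
    and state: "\<alpha> (n - 1) \<in> L2_space (surf_on (fault I Om))"
    and velocity: "v \<in> H0_contact_space I Om \<Gamma>D (u (n - 1))"
  shows "\<exists>a. solves_state_problem I Om \<psi> \<tau> (u (n - 1)) v (\<alpha> (n - 1)) a \<and>
           (\<forall>a'. solves_state_problem I Om \<psi> \<tau> (u (n - 1)) v (\<alpha> (n - 1)) a' \<longrightarrow>
              (AE x in surf_on (fault I Om). a' x = a x))"
proof -
  let ?F = "fault I Om" and ?B = "contact_bottom I Om (u (n - 1))"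
  define M where "M = surf_on ?F"
  define w where "w = jump I Om (u (n - 1)) v"
  (* Extension by zero off the contact set makes the whole fault the domain of integration. *)
  define s where "s x = 1 / L * (indicator ?B x * norm (w x))" for x
  define J where "J \<beta> = state_functional I Om \<psi> (u (n - 1)) \<beta> v" for \<beta>
  have F: "?F \<in> sets surf" by (intro closed_sets_surf closed_fault)
  have B: "?B \<in> sets surf" using deformation(3) by (simp add: regular_contact_def Let_def)
  have "?B \<subseteq> ?F" by (auto simp: contact_bottom_def)
  then have BM: "?B \<in> sets M" using F B by (simp add: M_def sets_restrict_space_iff)
  have restrict: "surf_on ?B = restrict_space M ?B"
    using F B \<open>?B \<subseteq> ?F\<close> unfolding M_def
    by (subst restrict_restrict_space) (auto simp: Int_absorb1)
  have M: "finite_measure M"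
    using emeasure_surf_fault_finite[OF decomposition] F
    by (intro finite_measureI) (simp add: M_def space_restrict_space emeasure_restrict_space)
  have "v \<in> H_space I Om"
    using velocity by (simp add: H0_contact_space_def H0_space_def)
  then have "w \<in> L2_space (restrict_space M ?B)"
    using L2_space_jump[OF decomposition _ deformation(3)] unfolding w_def restrict by blast
  then have "(\<lambda>x. indicator ?B x *\<^sub>R w x) \<in> L2_space M"
    using BM by (simp add: L2_space_restrict_space_iff)
  then have s: "s \<in> L2_space M"
    using L2_space_cmult[OF L2_space_norm, of "\<lambda>x. indicator ?B x *\<^sub>R w x" M "1 / L"]
    by (simp add: s_def[abs_def])
  have s_nonneg: "0 \<le> s x" for x using constants by (simp add: s_def)
  have J: "J \<beta> = ext_integral M (\<lambda>x. indicator ?B x * \<psi> (\<beta> x) (L * s x))" for \<beta>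
  proof -
    have "J \<beta> = ext_integral M (\<lambda>x. indicator ?B x * \<psi> (\<beta> x) (norm (w x)))"
      unfolding J_def state_functional_def restrict w_def
      using BM by (intro ext_integral_restrict_space) simp
    also have "(\<lambda>x. indicator ?B x * \<psi> (\<beta> x) (norm (w x))) = (\<lambda>x. indicator ?B x * \<psi> (\<beta> x) (L * s x))"
      using constants by (auto simp: s_def indicator_def)
    finally show ?thesis .
  qed
  have reduce: "solves_state_problem I Om \<psi> \<tau> (u (n - 1)) v (\<alpha> (n - 1)) a
      \<longleftrightarrow> solves_proximal_inequality M \<tau> J (\<alpha> (n - 1)) a" for a
    by (simp add: solves_state_problem_def solves_proximal_inequality_def J_def M_def Let_def)
  have "\<exists>a. solves_proximal_inequality M \<tau> J (\<alpha> (n - 1)) a \<and>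
      (\<forall>a'. solves_proximal_inequality M \<tau> J (\<alpha> (n - 1)) a' \<longrightarrow> (AE x in M. a' x = a x))"
    using law
  proof
    assume "\<psi> = dieterich_law L"
    then have "J \<beta> = ext_integral M (\<lambda>x. indicator ?B x * (s x * \<beta> x + exp (- \<beta> x)))" for \<beta>
      using constants J by (simp add: dieterich_law_def)
    then show ?thesis
      using state unfolding M_def[symmetric]
      by (intro dieterich_state_problem_solvable[OF M BM constants(1) s _ s_nonneg])
  next
    assume "\<psi> = ruina_law L"
    then have "J \<beta> = ext_integral M
        (\<lambda>x. indicator ?B x * (s x * (1 / 2 * (\<beta> x)\<^sup>2 + ln (s x) * \<beta> x)))" for \<beta>
      using constants J by (simp add: ruina_law_def)
    then show ?thesis
      using state unfolding M_def[symmetric]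
      by (intro ruina_state_problem_solvable[OF M BM constants(1) s _ s_nonneg])
  qed
  then show ?thesis by (simp only: reduce M_def)
qed

end
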